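(* Let $r\ge 1$ be an integer. Every Iterated Paley Simplicial Complex $X_{n,p}$ with $p>2^{2^r+2r}$ and $n>r^2p^{2r}$ is $r$-ample.
   Context: For a simplicial complex $X$, $V(X)$ is its vertex set; for $U\subseteq V(X)$, $X_U$ is the induced subcomplex on $U$ (vertex set $U$, whose simplices are exactly the simplices of $X$ with all vertices in $U$). For a vertex $v$, the link ${\rm lk}_X(v)$ is the subcomplex of all simplices $\sigma$ of $X$ with $v\notin\sigma$ such that $\sigma\cup\{v\}$ is a simplex of $X$. Subcomplexes are allowed to be empty. For an integer $r\ge 1$, a nonempty simplicial complex $X$ is $r$-ample if for each $U\subseteq V(X)$ with $|U|\le r$ and each subcomplex $A\subseteq X_U$ (possibly empty) there is a vertex $v\in V(X)\setminus U$ with ${\rm lk}_X(v)\cap X_U=A$. Iterated Paley Simplicial Complex: let $n$ be an odd prime power, $p$ an odd prime dividing $n-1$, and $g$ a primitive element (generator of the multiplicative group) of the finite field $\mathbb{F}_n$. Put $$Q_{n,p}=\{g^\alpha \mid \alpha\equiv\beta^2 \bmod p \text{ for } \alpha,\beta\in\mathbb{Z}\}\subset\mathbb{F}_n .$$ The complex $X_{n,p}$ has vertex set $\mathbb{F}_n$, and a nonempty set $\{x_1,\dots,x_t\}\subseteq\mathbb{F}_n$ of distinct elements forms a simplex if for every nonempty subset $\{x_{s_1},\dots,x_{s_k}\}\subseteq\{x_1,\dots,x_t\}$ one has $$\prod_{1\le i<j\le k}(x_{s_i}-x_{s_j})\in Q_{n,p}$$ (the empty product is $1$; the condition does not depend on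 the ordering since $-1=g^{(n-1)/2}$ with $p\mid (n-1)/2$). The definition depends on the choice of $g$; the claim is for any choice of $g$. *)

theory Defs
  imports Complex_Main "HOL-Number_Theory.Number_Theory" "HOL-Library.Cardinality"
begin

text \<open>
  A simplicial complex is represented by its set of nonempty finite simplices; its vertex set is
  the union of the simplices (equivalently, the set of all v such that {v} is a simplex).  The
  empty set of simplices is the empty complex.  Intersection and inclusion of complexes are then
  intersection and inclusion of sets.
\<close>

definition abstract_simplicial_complex :: "'a set set \<Rightarrow> bool" where
  "abstract_simplicial_complex X \<longleftrightarrow>
     (\<forall>\<sigma>\<in>X. finite \<sigma> \<and> \<sigma> \<noteq> {} \<and> (\<forall>\<tau>. \<tau> \<subseteq> \<sigma> \<longrightarrow> \<tau> \<noteq> {} \<longrightarrow> \<tau> \<in> X))"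

definition vertex_set :: "'a set set \<Rightarrow> 'a set" where
  "vertex_set X = \<Union>X"

definition induced_subcomplex :: "'a set set \<Rightarrow> 'a set \<Rightarrow> 'a set set" where
  "induced_subcomplex X U = {\<sigma> \<in> X. \<sigma> \<subseteq> U}"

definition vertex_link :: "'a set set \<Rightarrow> 'a \<Rightarrow> 'a set set" where
  "vertex_link X v = {\<sigma> \<in> X. v \<notin> \<sigma> \<and> insert v \<sigma> \<in> X}"

definition ample_complex :: "nat \<Rightarrow> 'a set set \<Rightarrow> bool" where
  "ample_complex r X \<longleftrightarrow>
     abstract_simplicial_complex X \<and> X \<noteq> {} \<and>
     (\<forall>U A. U \<subseteq> vertex_set X \<longrightarrow> finite U \<longrightarrow> card U \<le> r \<longrightarrow>
        abstract_simplicial_complex A \<longrightarrow> A \<subseteq> induced_subcomplex X U \<longrightarrow>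
        (\<exists>v \<in> vertex_set X - U. vertex_link X v \<inter> induced_subcomplex X U = A))"

text \<open>Finite fields are types of class field and finite; the order is CARD('a).\<close>

definition primitive_element :: "'a::{field,finite} \<Rightarrow> bool" where
  "primitive_element g \<longleftrightarrow> range (\<lambda>k::int. g powi k) = UNIV - {0}"

definition paley_set :: "nat \<Rightarrow> 'a::{field,finite} \<Rightarrow> 'a set" where
  "paley_set p g = {g powi \<alpha> | \<alpha> \<beta>::int. [\<alpha> = \<beta>\<^sup>2] (mod int p)}"

definition diff_prod :: "'a::{field,finite} list \<Rightarrow> 'a" where
  "diff_prod xs = (\<Prod>j<length xs. \<Prod>i<j. xs ! i - xs ! j)"

text \<open>
  Nonempty subsets are listed by nonempty distinct lists.  Membership of the product in the
  Paley set is required for every ordering of a subset; when p is an odd divisor of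
  CARD('a) - 1 and CARD('a) is odd, it does not depend on the ordering.
\<close>

definition iterated_paley_complex :: "nat \<Rightarrow> 'a::{field,finite} \<Rightarrow> 'a set set" where
  "iterated_paley_complex p g =
     {\<sigma>. \<sigma> \<noteq> {} \<and>
        (\<forall>xs. distinct xs \<longrightarrow> xs \<noteq> [] \<longrightarrow> set xs \<subseteq> \<sigma> \<longrightarrow> diff_prod xs \<in> paley_set p g)}"

end

theory Submission
  imports Defs "HOL-Computational_Algebra.Polynomial" "HOL-Analysis.Convex"
begin

text \<open>Let \<open>cl x\<close> be the discrete logarithm of \<open>x\<close> modulo \<open>p\<close>. For \<open>v\<close> outside \<open>U\<close>, the simplices of the link of \<open>v\<close>
  inside \<open>U\<close> depend only on which of the numbers \<open>pw \<tau> + (\<Sum>u\<in>\<tau>. cl (v - u))\<close>, \<open>\<tau> \<subseteq> U\<close>, are squares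
  modulo \<open>p\<close>, where \<open>pw \<tau>\<close> is the class of the difference product of \<open>\<tau>\<close>. Choosing the coordinates one
  at a time, a bound for sums of quadratic characters over products of linear factors yields
  many class vectors in \<open>(\<int>/p)^U\<close> with any prescribed pattern of squares and nonsquares. A second
  moment estimate, based on a bound for characters of order \<open>p\<close>, shows that the class vectors
  \<open>(cl (v - u))\<^sub>u\<close> of the points \<open>v\<close> are too evenly distributed to avoid so large a set. In place of the
  Weil bound both estimates use Stepanov's polynomial method; its loss of a factor \<open>p\<close> for
  characters of order \<open>p\<close> is compensated by the number of admissible class vectors.\<close>

section \<open>Polynomials modulo a prime ideal\<close>

text \<open>For \<open>m = card U \<ge> 3\<close> the admissible class vectors have density at least
  \<open>1 / Q\<close> with \<open>Q = 2^(2^m + m + 1)\<close>, and the condition on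
  \<open>p\<close> gives \<open>4 Q < p\<close>. The second moment estimate hits every set of
  density above about \<open>3 / p\<close> once \<open>n > m^2 p^(m + 3)\<close>. A single class
  vector, of density \<open>p^(-m)\<close>, would need \<open>n\<close> of order
  \<open>m^2 p^(2 m + 2)\<close>, more than is assumed when \<open>m = r\<close>; this is why many
  vectors are counted instead of one being found. The condition on \<open>p\<close> is spent a
  second time in that count. The last of \<open>r\<close> coordinates must satisfy
  \<open>k = 2^(r - 1)\<close> prescribed quadratic symbols at once, so the main term
  \<open>p / 2^k\<close> has to beat an error of order \<open>k sqrt p\<close>. The critical size of
  \<open>sqrt p\<close> is \<open>k 2^k = 2^(2^(r - 1) + r - 1)\<close>, and the hypothesis provides
  twice as much.\<close>

lemma pcompose_power: "(P ^ n) \<circ>\<^sub>p Q = (P \<circ>\<^sub>p Q) ^ n"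
  for P Q :: "'a::comm_ring_1 poly"
  by (induction n) (simp_all add: pcompose_1 pcompose_mult)

text \<open>Ideals are given by membership predicates \<open>z\<close>, and the residue field is never formed:
  Stepanov's bound is needed both for the field of the statement and for the field with \<open>p\<close>
  elements, and no type with \<open>p\<close> elements is available for a variable \<open>p\<close>.\<close>

locale ideal_pred =
  fixes z :: "'r::comm_ring_1 \<Rightarrow> bool"
  assumes z_0: "z 0"
    and z_add: "z a \<Longrightarrow> z b \<Longrightarrow> z (a + b)"
    and z_mult: "z a \<Longrightarrow> z (a * b)"
begin

lemma z_mult': "z b \<Longrightarrow> z (a * b)"
  using z_mult[of b a] by (simp add: mult.commute)

lemma z_minus: "z a \<Longrightarrow> z (- a)"
  using z_mult[of a "- 1"] by simp

lemma z_diff: "z a \<Longrightarrow> z b \<Longrightarrow> z (a - b)"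
  using z_add[of a "- b"] z_minus by simp

lemma z_sum: "(\<And>i. i \<in> A \<Longrightarrow> z (f i)) \<Longrightarrow> z (sum f A)"
  by (induction A rule: infinite_finite_induct) (auto simp: z_0 z_add)

lemma z_sum_diff: "(\<And>i. i \<in> A \<Longrightarrow> z (f i - g i)) \<Longrightarrow> z (sum f A - sum g A)"
  using z_sum[of A "\<lambda>i. f i - g i"] by (simp add: sum_subtractf)

lemma z_cong: "z (a - b) \<Longrightarrow> z a \<longleftrightarrow> z b"
  using z_add[of "a - b" b] z_diff[of a "a - b"] by auto

lemma z_add_iff: "z b \<Longrightarrow> z (a + b) \<longleftrightarrow> z a"
  using z_cong[of "a + b" a] by simp

lemma z_diff_sym: "z (a - b) \<Longrightarrow> z (b - a)"
  using z_minus by fastforce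

lemma z_diff_trans: "z (a - b) \<Longrightarrow> z (b - c) \<Longrightarrow> z (a - c)"
  using z_add[of "a - b" "b - c"] by simp

lemma z_mult_diff:
  assumes "z (a - b)" "z (c - d)"
  shows "z (a * c - b * d)"
proof -
  have "a * c - b * d = (a - b) * c + b * (c - d)" by (simp add: algebra_simps)
  then show ?thesis using assms by (simp add: z_add z_mult z_mult')
qed

lemma z_power_diff: "z (a - b) \<Longrightarrow> z (a ^ n - b ^ n)"
  by (induction n) (auto simp: z_0 intro: z_mult_diff)

lemma z_prod_diff: "(\<And>i. i \<in> A \<Longrightarrow> z (f i - g i)) \<Longrightarrow> z (prod f A - prod g A)"
  by (induction A rule: infinite_finite_induct) (auto simp: z_0 intro: z_mult_diff)

text \<open>The inner binomial coefficients of row \<open>ch\<close> are multiples of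
  \<open>ch\<close>, hence lie in the ideal; iteration passes from \<open>ch\<close> to its
  powers.\<close>

lemma frobenius_add:
  assumes "prime ch" "z (of_nat ch)"
  shows "z ((a + b) ^ (ch ^ e) - (a ^ (ch ^ e) + b ^ (ch ^ e)))"
proof -
  have step: "z ((x + y) ^ ch - (x ^ ch + y ^ ch))" for x y
  proof -
    have c2: "ch \<ge> 2" using assms(1) prime_ge_2_nat by blast
    let ?f = "\<lambda>k. of_nat (ch choose k) * x ^ k * y ^ (ch - k)"
    have "{..ch} = insert 0 (insert ch {0<..<ch})" using c2 by auto
    then have "(x + y) ^ ch = ?f 0 + ?f ch + sum ?f {0<..<ch}"
      using c2 by (simp add: binomial_ring)
    then have "(x + y) ^ ch - (x ^ ch + y ^ ch) = sum ?f {0<..<ch}"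
      by (simp add: algebra_simps)
    moreover have "z (sum ?f {0<..<ch})"
    proof (rule z_sum)
      fix k assume "k \<in> {0<..<ch}"
      then have "ch dvd (ch choose k)" by (intro dvd_choose_prime) (use assms in auto)
      then obtain c where c: "ch choose k = ch * c" by (elim dvdE)
      show "z (?f k)" unfolding c of_nat_mult by (intro z_mult assms(2))
    qed
    ultimately show ?thesis by simp
  qed
  show ?thesis
  proof (induction e)
    case (Suc e)
    let ?q = "ch ^ e"
    have "z (((a + b) ^ ?q) ^ ch - (a ^ ?q + b ^ ?q) ^ ch)"
      using Suc by (rule z_power_diff)
    from z_diff_trans[OF this step] show ?case by (simp flip: power_mult add: mult.commute)
  qed (simp add: z_0)
qed

end

locale prime_pred = ideal_pred z for z :: "'r::idom \<Rightarrow> bool" +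
  assumes z_1: "\<not> z 1"
    and z_mult_cases: "z (a * b) \<Longrightarrow> z a \<or> z b"
begin

lemma z_mult_iff: "z (a * b) \<longleftrightarrow> z a \<or> z b"
  using z_mult z_mult' z_mult_cases by blast

lemma z_power: "z (a ^ n) \<Longrightarrow> z a"
  by (induction n) (auto simp: z_1 z_mult_iff)

lemma z_prod: "finite A \<Longrightarrow> z (prod f A) \<Longrightarrow> \<exists>i\<in>A. z (f i)"
  by (induction A rule: finite_induct) (auto simp: z_1 z_mult_iff)

end

text \<open>\<open>zp P\<close> says that \<open>P\<close> reduces to 0 over the residue ring,
  \<open>zlow M P\<close> below that it does so modulo \<open>x^M\<close>. Both predicates are
  ideals, so the congruence rules of the locale apply to them again.\<close>

definition (in ideal_pred) zp :: "'r poly \<Rightarrow> bool" where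
  "zp P \<longleftrightarrow> (\<forall>n. z (coeff P n))"

definition (in ideal_pred) zlow :: "nat \<Rightarrow> 'r poly \<Rightarrow> bool" where
  "zlow M P \<longleftrightarrow> (\<forall>l<M. z (coeff P l))"

context ideal_pred
begin

lemma ideal_zlow: "ideal_pred (zlow M)"
proof
  fix a b :: "'r poly"
  assume "zlow M a"
  then show "zlow M (a * b)"
    by (auto simp: zlow_def coeff_mult intro!: z_sum z_mult)
qed (auto simp: zlow_def z_0 z_add)

lemma ideal_zp: "ideal_pred zp"
  by standard (auto simp: zp_def z_0 z_add coeff_mult intro!: z_sum z_mult)

lemma zp_pCons: "zp (pCons c P) \<longleftrightarrow> z c \<and> zp P"
  unfolding zp_def by (metis coeff_pCons_0 coeff_pCons_Suc not0_implies_Suc)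

lemma zp_imp_zlow: "zp P \<Longrightarrow> zlow M P"
  by (simp add: zp_def zlow_def)

lemma zp_pcompose: "zp P \<Longrightarrow> zp (P \<circ>\<^sub>p Q)"
proof (induction P)
  case (pCons a P)
  interpret zp: ideal_pred zp by (rule ideal_zp)
  from pCons show ?case
    by (auto simp: zp_pCons pcompose_pCons zp.z_0 intro!: zp.z_add zp.z_mult')
qed (simp add: zp_def z_0)

lemma zp_poly: "zp P \<Longrightarrow> z (poly P a)"
  by (induction P) (auto simp: zp_pCons z_0 intro!: z_add z_mult')

text \<open>The Taylor expansion at \<open>a\<close> is cut at order \<open>M\<close>: the lower
  part reduces to 0, the rest carries the factor \<open>(x - a)^M\<close>.\<close>

lemma zlow_taylor_dvd:
  assumes "zlow M (P \<circ>\<^sub>p [:a, 1:])"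
  shows "\<exists>Q. zp (P - [:- a, 1:] ^ M * Q)"
proof -
  let ?S = "P \<circ>\<^sub>p [:a, 1:]"
  have S: "?S = poly_cutoff M ?S + monom 1 M * poly_shift M ?S"
    by (rule poly_eqI) (auto simp: coeff_poly_cutoff coeff_poly_shift coeff_monom_mult)
  have "P = ?S \<circ>\<^sub>p [:- a, 1:]"
    by (simp flip: pcompose_assoc add: pcompose_pCons)
  also have "\<dots> = poly_cutoff M ?S \<circ>\<^sub>p [:- a, 1:]
      + [:- a, 1:] ^ M * (poly_shift M ?S \<circ>\<^sub>p [:- a, 1:])"
    by (subst S) (simp add: pcompose_add pcompose_mult monom_altdef pcompose_power pcompose_smult pcompose_pCons)
  finally have "P - [:- a, 1:] ^ M * (poly_shift M ?S \<circ>\<^sub>p [:- a, 1:])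
      = poly_cutoff M ?S \<circ>\<^sub>p [:- a, 1:]"
    unfolding diff_eq_eq .
  moreover have "zp (poly_cutoff M ?S)"
    using assms by (auto simp: zp_def zlow_def coeff_poly_cutoff z_0)
  ultimately show ?thesis using zp_pcompose by metis
qed

end

context prime_pred
begin

text \<open>Gauss's lemma. With \<open>n\<close> and \<open>m\<close> the least indices of
  coefficients outside the ideal, coefficient \<open>n + m\<close> of the product has exactly one
  term outside it.\<close>

lemma prime_zp: "prime_pred zp"
proof -
  interpret zp: ideal_pred zp by (rule ideal_zp)
  show ?thesis
  proof
    show "\<not> zp 1" by (auto simp: zp_def z_1 intro!: exI[of _ 0])
  next
    fix A B assume AB: "zp (A * B)"
    show "zp A \<or> zp B"
    proof (rule ccontr)
      assume "\<not> (zp A \<or> zp B)"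
      then have A: "\<exists>n. \<not> z (coeff A n)" and B: "\<exists>n. \<not> z (coeff B n)" by (auto simp: zp_def)
      define n m where "n = (LEAST n. \<not> z (coeff A n))" and "m = (LEAST n. \<not> z (coeff B n))"
      have n: "\<not> z (coeff A n)" "\<And>i. i < n \<Longrightarrow> z (coeff A i)"
        using LeastI_ex[OF A] not_less_Least[of _ "\<lambda>n. \<not> z (coeff A n)"] unfolding n_def by blast+
      have m: "\<not> z (coeff B m)" "\<And>i. i < m \<Longrightarrow> z (coeff B i)"
        using LeastI_ex[OF B] not_less_Least[of _ "\<lambda>n. \<not> z (coeff B n)"] unfolding m_def by blast+
      have "coeff (A * B) (n + m) = coeff A n * coeff B m
          + (\<Sum>i\<in>{..n + m} - {n}. coeff A i * coeff B (n + m - i))"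
        by (simp add: coeff_mult sum.remove[of _ n])
      moreover have "z (\<Sum>i\<in>{..n + m} - {n}. coeff A i * coeff B (n + m - i))"
      proof (rule z_sum)
        fix i assume i: "i \<in> {..n + m} - {n}"
        show "z (coeff A i * coeff B (n + m - i))"
        proof (cases "i < n")
          case False
          with i have "n + m - i < m" by auto
          then show ?thesis by (intro z_mult' m)
        qed (intro z_mult n)
      qed
      moreover have "z (coeff (A * B) (n + m))" using AB by (simp add: zp_def)
      ultimately have "z (coeff A n * coeff B m)"
        using z_diff by (metis add_diff_cancel_right')
      then show False using n m by (simp add: z_mult_iff)
    qed
  qed
qed

text \<open>Stands in for unique factorization over the residue field. The factors
  \<open>x - a\<close> are split off from \<open>Q\<close> one at a time: cancelling
  \<open>(x - a)^i\<close> leaves an identity whose value at \<open>a\<close> forces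
  \<open>Q'\<close> to vanish there, since \<open>W\<close> does not.\<close>

lemma zp_dvd_coprime_power:
  assumes PW: "zp (P - W * Q)" and Pa: "zp (P - [:- a, 1:] ^ M * R)"
    and W: "\<not> z (poly W a)"
  shows "\<exists>Q'. zp (Q - [:- a, 1:] ^ M * Q')"
proof -
  interpret zp: prime_pred zp by (rule prime_zp)
  have "\<exists>Q'. zp (Q - [:- a, 1:] ^ i * Q')" if "i \<le> M" for i
    using that
  proof (induction i)
    case 0
    show ?case by (rule exI[of _ Q]) (simp add: zp.z_0)
  next
    case (Suc i)
    let ?X = "[:- a, 1:]"
    from Suc obtain Q' where Q': "zp (Q - ?X ^ i * Q')" by auto
    have M: "?X ^ M = ?X ^ i * (?X * ?X ^ (M - Suc i))"
      using Suc.prems by (simp flip: power_add power_Suc)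
    have "zp (W * Q - W * (?X ^ i * Q'))"
      using Q' by (intro zp.z_mult_diff) (auto simp: zp.z_0)
    then have "zp (W * (?X ^ i * Q') - ?X ^ M * R)"
      using zp.z_diff_trans[OF zp.z_diff_sym[OF zp.z_diff_trans[OF PW \<open>zp (W * Q - _)\<close>]] Pa] by simp
    also have "W * (?X ^ i * Q') - ?X ^ M * R = ?X ^ i * (W * Q' - ?X * (?X ^ (M - Suc i) * R))"
      unfolding M by (simp only: right_diff_distrib mult_ac)
    finally have "zp (?X ^ i) \<or> zp (W * Q' - ?X * (?X ^ (M - Suc i) * R))"
      by (rule zp.z_mult_cases)
    moreover have "\<not> zp (?X ^ i)"
      using zp.z_power[of ?X i] z_1 by (auto simp: zp_pCons)
    ultimately have "z (poly (W * Q' - ?X * (?X ^ (M - Suc i) * R)) a)" by (blast intro: zp_poly)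
    then have "z (poly Q' a)" using W by (simp add: z_mult_iff)
    have "Q' - ?X * synthetic_div Q' a = [:poly Q' a:]"
      using synthetic_div_correct'[of a Q'] by (metis add_diff_cancel_left')
    then have "zp (Q' - ?X * synthetic_div Q' a)"
      using \<open>z (poly Q' a)\<close> by (simp add: zp_pCons zp.z_0)
    then have "zp (?X ^ i * Q' - ?X ^ i * (?X * synthetic_div Q' a))"
      by (intro zp.z_mult_diff) (auto simp: zp.z_0)
    with Q' have "zp (Q - ?X ^ i * (?X * synthetic_div Q' a))" by (rule zp.z_diff_trans)
    then show ?case by (intro exI[of _ "synthetic_div Q' a"]) (simp only: power_Suc mult_ac)
  qed
  then show ?thesis by blast
qed

lemma zp_dvd_prod:
  assumes "finite Z" "\<And>a b. a \<in> Z \<Longrightarrow> b \<in> Z \<Longrightarrow> a \<noteq> b \<Longrightarrow> \<not> z (a - b)"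
    and "\<And>a. a \<in> Z \<Longrightarrow> \<exists>Q. zp (P - [:- a, 1:] ^ M * Q)"
  shows "\<exists>Q. zp (P - (\<Prod>a\<in>Z. [:- a, 1:] ^ M) * Q)"
  using assms
proof (induction Z rule: finite_induct)
  case empty
  interpret zp: prime_pred zp by (rule prime_zp)
  show ?case by (rule exI[of _ P]) (simp add: zp.z_0)
next
  case (insert a Z)
  interpret zp: prime_pred zp by (rule prime_zp)
  let ?W = "\<Prod>a\<in>Z. [:- a, 1:] ^ M"
  from insert obtain Q where Q: "zp (P - ?W * Q)" by auto
  from insert.prems(2)[of a] obtain R where R: "zp (P - [:- a, 1:] ^ M * R)" by auto
  have "\<not> z (poly ?W a)"
  proof
    assume "z (poly ?W a)"
    then obtain b where "b \<in> Z" "z ((a - b) ^ M)"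
      using z_prod[OF insert.hyps(1), of "\<lambda>b. (a - b) ^ M"] by (auto simp: poly_prod)
    then show False using insert.prems(1)[of a b] insert.hyps z_power by auto
  qed
  from zp_dvd_coprime_power[OF Q R this] obtain Q' where Q': "zp (Q - [:- a, 1:] ^ M * Q')" by auto
  have "zp (?W * Q - ?W * ([:- a, 1:] ^ M * Q'))"
    using Q' by (intro zp.z_mult_diff) (auto simp: zp.z_0)
  with Q have "zp (P - ?W * ([:- a, 1:] ^ M * Q'))" by (rule zp.z_diff_trans)
  then show ?case using insert.hyps by (intro exI[of _ Q']) (simp add: mult_ac)
qed

text \<open>\<open>degree P\<close> is measured before reduction and may exceed the degree of the
  reduction, while \<open>W\<close> is monic and keeps its degree. The last coefficient of
  \<open>Q\<close> outside the ideal yields a nonzero coefficient of \<open>P\<close>.\<close>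

lemma degree_ge_of_monic_dvd:
  assumes "\<not> zp P" "zp (P - W * Q)" "coeff W (degree W) = 1"
  shows "degree W \<le> degree P"
proof -
  interpret zp: prime_pred zp by (rule prime_zp)
  have "\<not> zp Q" using assms zp.z_cong zp.z_mult' by blast
  then have ne: "{n. \<not> z (coeff Q n)} \<noteq> {}" by (auto simp: zp_def)
  have "{n. \<not> z (coeff Q n)} \<subseteq> {..degree Q}"
    using z_0 by (auto intro: le_degree)
  then have fin: "finite {n. \<not> z (coeff Q n)}" by (rule finite_subset) simp
  define t where "t = Max {n. \<not> z (coeff Q n)}"
  have t: "\<not> z (coeff Q t)" using Max_in[OF fin ne] by (simp add: t_def)
  have t': "z (coeff Q n)" if "n > t" for n
    using Max_ge[OF fin, of n] that by (auto simp: t_def)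
  let ?D = "degree W"
  have "coeff (W * Q) (?D + t) = coeff W ?D * coeff Q t
      + (\<Sum>i\<in>{..?D + t} - {?D}. coeff W i * coeff Q (?D + t - i))"
    by (simp add: coeff_mult sum.remove[of _ ?D])
  moreover have "z (\<Sum>i\<in>{..?D + t} - {?D}. coeff W i * coeff Q (?D + t - i))"
  proof (rule z_sum)
    fix i assume i: "i \<in> {..?D + t} - {?D}"
    show "z (coeff W i * coeff Q (?D + t - i))"
    proof (cases "i < ?D")
      case True
      then show ?thesis by (intro z_mult' t') auto
    qed (use i z_0 in \<open>auto simp: coeff_eq_0\<close>)
  qed
  ultimately have "\<not> z (coeff (W * Q) (?D + t))"
    using t assms(3) z_diff by (metis add_diff_cancel_right' mult_1)
  moreover have "z (coeff P (?D + t) - coeff (W * Q) (?D + t))"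
    using assms(2) unfolding zp_def coeff_diff by blast
  ultimately have "coeff P (?D + t) \<noteq> 0" using z_cong z_0 by metis
  then show ?thesis using le_degree by fastforce
qed

end

text \<open>Pigeonhole in place of linear algebra: there are more coefficient vectors over
  \<open>R\<close> than vectors of values on \<open>C\<close>, so two of them have the same values
  modulo the ideal, and their difference solves the system.\<close>

lemma (in prime_pred) small_homogeneous_solution:
  fixes m :: "'c \<Rightarrow> 'k \<Rightarrow> 'r"
  assumes fin: "finite K" "finite C" and card: "card C < card K"
    and R: "finite R" "\<And>x. rho x \<in> R" "\<And>x. z (x - rho x)"
      "\<And>x y. x \<in> R \<Longrightarrow> y \<in> R \<Longrightarrow> x \<noteq> y \<Longrightarrow> \<not> z (x - y)"
  shows "\<exists>\<beta>. (\<exists>\<kappa>\<in>K. \<not> z (\<beta> \<kappa>)) \<and> (\<forall>c\<in>C. z (\<Sum>\<kappa>\<in>K. \<beta> \<kappa> * m c \<kappa>))"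
proof -
  define f where "f \<beta> = restrict (\<lambda>c. rho (\<Sum>\<kappa>\<in>K. \<beta> \<kappa> * m c \<kappa>)) C" for \<beta> :: "'k \<Rightarrow> 'r"
  have "rho 0 \<noteq> rho 1"
  proof
    assume "rho 0 = rho 1"
    then have "z (1 - 0)" using z_diff_trans[OF R(3)[of 1], of 0] z_diff_sym[OF R(3)[of 0]] by simp
    then show False using z_1 by simp
  qed
  then have "1 < card R" using R card_le_Suc0_iff_eq by (metis not_le One_nat_def)
  then have lt: "card R ^ card C < card R ^ card K" using card by (rule power_strict_increasing[rotated])
  have "f ` (K \<rightarrow>\<^sub>E R) \<subseteq> C \<rightarrow>\<^sub>E R" by (auto simp: f_def R)
  moreover have "finite (C \<rightarrow>\<^sub>E R)" "card (C \<rightarrow>\<^sub>E R) < card (K \<rightarrow>\<^sub>E R)"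
    using lt fin R(1) by (auto simp: card_PiE finite_PiE)
  ultimately have "\<not> inj_on f (K \<rightarrow>\<^sub>E R)"
    by (meson card_inj_on_le leD)
  then obtain \<beta> \<beta>' where b: "\<beta> \<in> K \<rightarrow>\<^sub>E R" "\<beta>' \<in> K \<rightarrow>\<^sub>E R" "f \<beta> = f \<beta>'" "\<beta> \<noteq> \<beta>'"
    by (auto simp: inj_on_def)
  then obtain \<kappa> where k: "\<kappa> \<in> K" "\<beta> \<kappa> \<noteq> \<beta>' \<kappa>" by (meson PiE_ext)
  have "\<not> z (\<beta> \<kappa> - \<beta>' \<kappa>)" using b k R(4) by auto
  moreover have "z (\<Sum>\<kappa>\<in>K. (\<beta> \<kappa> - \<beta>' \<kappa>) * m c \<kappa>)" if "c \<in> C" for c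
  proof -
    let ?s = "\<Sum>\<kappa>\<in>K. \<beta> \<kappa> * m c \<kappa>" and ?s' = "\<Sum>\<kappa>\<in>K. \<beta>' \<kappa> * m c \<kappa>"
    have "rho ?s = rho ?s'" using fun_cong[OF b(3), of c] that by (simp add: f_def)
    then have "z (?s - ?s')" using z_diff_trans[OF R(3)[of ?s], of ?s'] z_diff_sym[OF R(3)[of ?s']] by simp
    then show ?thesis by (simp add: left_diff_distrib sum_subtractf)
  qed
  ultimately show ?thesis using k(1) by (intro exI[of _ "\<lambda>\<kappa>. \<beta> \<kappa> - \<beta>' \<kappa>"]) auto
qed

section \<open>Stepanov's polynomial method\<close>

lemma degree_coeff_mult_le:
  fixes G H :: "'a::comm_ring_1 poly poly"
  assumes "\<And>l. degree (coeff G l) \<le> l * c" "\<And>l. degree (coeff H l) \<le> l * c"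
  shows "degree (coeff (G * H) l) \<le> l * c"
  unfolding coeff_mult
proof (rule degree_sum_le)
  fix i assume "i \<in> {..l}"
  then have "i * c + (l - i) * c = l * c" by (simp flip: add_mult_distrib)
  moreover have "degree (coeff G i * coeff H (l - i)) \<le> i * c + (l - i) * c"
    by (intro order.trans[OF degree_mult_le] add_mono assms)
  ultimately show "degree (coeff G i * coeff H (l - i)) \<le> l * c" by simp
qed simp

lemma degree_coeff_power_le:
  fixes G :: "'a::comm_ring_1 poly poly"
  assumes "\<And>l. degree (coeff G l) \<le> l * c"
  shows "degree (coeff (G ^ n) l) \<le> l * c"
proof (induction n arbitrary: l)
  case (Suc n)
  show ?case unfolding power_Suc by (rule degree_coeff_mult_le) (fact assms Suc)+
qed (simp add: coeff_1)

lemma degree_coeff_prod_le: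
  fixes G :: "'i \<Rightarrow> 'a::comm_ring_1 poly poly"
  assumes "\<And>i l. i \<in> A \<Longrightarrow> degree (coeff (G i) l) \<le> l * c"
  shows "degree (coeff (prod G A) l) \<le> l * c"
  using assms
proof (induction A arbitrary: l rule: infinite_finite_induct)
  case (insert i A)
  show ?case unfolding prod.insert[OF insert.hyps(1,2)]
    by (rule degree_coeff_mult_le) (use insert in auto)
qed (auto simp: coeff_1)

abbreviation eval_coeffs :: "'a::comm_ring_1 \<Rightarrow> 'a poly poly \<Rightarrow> 'a poly" where
  "eval_coeffs a \<equiv> map_poly (\<lambda>f. poly f a)"

lemma eval_coeffs_mult: "eval_coeffs a (G * H) = eval_coeffs a G * eval_coeffs a H"
  by (rule poly_eqI) (simp add: coeff_map_poly coeff_mult poly_sum)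

lemma eval_coeffs_1: "eval_coeffs a 1 = 1"
  by (rule poly_eqI) (simp add: coeff_map_poly coeff_1)

lemma eval_coeffs_power: "eval_coeffs a (G ^ n) = eval_coeffs a G ^ n"
  by (induction n) (simp_all add: eval_coeffs_1 eval_coeffs_mult)

lemma eval_coeffs_prod: "eval_coeffs a (prod G A) = (\<Prod>i\<in>A. eval_coeffs a (G i))"
  by (induction A rule: infinite_finite_induct) (simp_all add: eval_coeffs_1 eval_coeffs_mult)

lemma degree_prod_linear_powers:
  fixes Z :: "'a::idom set"
  shows "degree (\<Prod>a\<in>Z. [:- a, 1:] ^ n a) = (\<Sum>a\<in>Z. n a)"
  by (subst degree_prod_eq_sum_degree) (auto simp: degree_power_eq)

text \<open>By Frobenius the power \<open>q j\<close> turns \<open>a + w y\<close> into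
  \<open>a^j\<close> up to terms divisible by \<open>y^q\<close>, which the orders below
  \<open>M \<le> q\<close> do not see.\<close>

lemma (in ideal_pred) zlow_frobenius_linear:
  assumes "prime ch" "z (of_nat ch)" and q: "q = ch ^ f" and M: "M \<le> q"
    and fix_q: "z (a ^ q - a)"
  shows "zlow M ([:a, w:] ^ (q * j) - [:a ^ j:])"
proof -
  interpret low: ideal_pred "zlow M" by (rule ideal_zlow)
  interpret zp: ideal_pred zp by (rule ideal_zp)
  have "of_nat ch = [:of_nat ch :: 'r:]" by (simp add: of_nat_poly)
  then have "zp (of_nat ch)" using assms(2) by (simp add: zp_pCons zp.z_0)
  then have "zp (([:a:] + [:0, w:]) ^ q - ([:a:] ^ q + [:0, w:] ^ q))"
    unfolding q by (intro zp.frobenius_add assms(1))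
  then have "zlow M ([:a, w:] ^ q - ([:a:] ^ q + [:0, w:] ^ q))"
    by (simp add: zp_imp_zlow)
  moreover have "zlow M ([:0, w:] ^ q)"
  proof -
    have "[:0, w:] = monom w 1" by (simp add: monom_altdef)
    then have "[:0, w:] ^ q = monom (w ^ q) q" by (simp add: monom_power)
    then show ?thesis using M by (auto simp: zlow_def z_0)
  qed
  moreover have "zlow M ([:a:] ^ q - [:a:])"
    using fix_q by (auto simp: zlow_def poly_const_pow coeff_pCons z_0 split: nat.split)
  ultimately have "zlow M ([:a, w:] ^ q - ([:a:] ^ q + [:0, w:] ^ q) + ([:0, w:] ^ q + ([:a:] ^ q - [:a:])))"
    by (intro low.z_add)
  also have "A - (B + C) + (C + (B - D)) = A - D" for A B C D :: "'r poly" by simp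
  finally have "zlow M ([:a, w:] ^ q - [:a:])" .
  then have "zlow M (([:a, w:] ^ q) ^ j - [:a:] ^ j)" by (rule low.z_power_diff)
  then show ?thesis by (simp add: power_mult poly_const_pow)
qed

text \<open>The finite residue field enters through representatives \<open>R\<close> chosen by
  \<open>rho\<close>, its characteristic \<open>ch\<close> and the identity
  \<open>x^q = x\<close>.\<close>

locale residue_field_pred = prime_pred z for z :: "'r::idom \<Rightarrow> bool" +
  fixes R :: "'r set" and rho :: "'r \<Rightarrow> 'r" and ch f q :: nat
  assumes reps: "finite R" "\<And>x. rho x \<in> R" "\<And>x. z (x - rho x)"
      "\<And>x y. x \<in> R \<Longrightarrow> y \<in> R \<Longrightarrow> x \<noteq> y \<Longrightarrow> \<not> z (x - y)"
    and char: "prime ch" "z (of_nat ch)"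
    and order: "q = ch ^ f" "q > 1" "\<And>a. z (a ^ q - a)"

text \<open>The auxiliary polynomial combines the terms \<open>x^(q j + \<rho>) H\<^sub>i\<close> with \<open>j < J\<close>, \<open>\<rho> < q - 1\<close>, where
  \<open>i = \<rho> div s\<close> and \<open>x^(i s) H\<^sub>i\<close> is the product of the \<open>(x - t)^(s e i t)\<close>. Their orders of vanishing
  at \<open>0\<close> are distinct because \<open>e i 0 = i\<close>, so no nontrivial combination is zero. On \<open>Z\<close> the powers
  \<open>x^(q j)\<close> and \<open>x^(i s) H\<^sub>i\<close> act as \<open>x^j\<close> and \<open>\<gamma> i\<close>, which makes vanishing of order \<open>M\<close> a small linear
  system. Taylor coefficients are taken along \<open>a + W(a) y\<close>, \<open>W\<close> being the product of all \<open>x - t\<close>,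
  since this keeps them polynomial in \<open>a\<close> and replaces derivatives in small characteristic.\<close>

lemma (in residue_field_pred) stepanov_bound:
  fixes T Z :: "'r set" and e :: "nat \<Rightarrow> 'r \<Rightarrow> nat" and \<gamma> :: "nat \<Rightarrow> 'r"
  assumes d: "d * s = q - 1"
    and T: "finite T" "0 \<in> T" "\<And>t. t \<in> T \<Longrightarrow> t \<noteq> 0 \<Longrightarrow> \<not> z t"
    and e: "\<And>i. i < d \<Longrightarrow> e i 0 = i" "\<And>i t. i < d \<Longrightarrow> t \<in> T \<Longrightarrow> e i t < d"
    and Z: "finite Z" "\<And>a b. a \<in> Z \<Longrightarrow> b \<in> Z \<Longrightarrow> a \<noteq> b \<Longrightarrow> \<not> z (a - b)"
      "\<And>a t. a \<in> Z \<Longrightarrow> t \<in> T \<Longrightarrow> \<not> z (a - t)"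
      "\<And>a i. a \<in> Z \<Longrightarrow> i < d \<Longrightarrow> z ((\<Prod>t\<in>T. (a - t) ^ (s * e i t)) - \<gamma> i)"
    and M: "M \<le> q" and J: "(\<Sum>l<M. J + s - 1 + l * (card T - 1)) < J * (q - 1)"
  shows "M * card Z \<le> q * (J - 1) + (q - 2) + (card T - 1) * (d - 1) * s"
proof -
  interpret low: ideal_pred "zlow M" by (rule ideal_zlow)
  define k where "k = card T"
  have s: "s > 0" using d order(2) by (auto intro!: gr0I)
  have idx: "\<rho> div s < d" if "\<rho> < q - 1" for \<rho>
    using that s d by (simp add: less_mult_imp_div_less)
  \<comment> \<open>Along \<open>a + w y\<close>, with \<open>w\<close> the product of all
    \<open>a - t\<close>, a factor \<open>x - t\<close> becomes \<open>a - t\<close> times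
    \<open>1 + W t y\<close>, where \<open>W t\<close> omits \<open>x - t\<close> and is evaluated
    at \<open>a\<close>; no denominators in \<open>a\<close> arise.\<close>
  define W where "W t = (\<Prod>u\<in>T - {t}. [:- u, 1:])" for t
  \<comment> \<open>At \<open>t = 0\<close> the exponent is
    \<open>\<rho> = s i + \<rho> mod s\<close>. Since \<open>e i 0 = i\<close>, the part
    \<open>s i\<close> is absorbed by \<open>\<gamma> i\<close>, and the rest stays as the power
    \<open>\<rho> mod s\<close> of \<open>a\<close> in \<open>B\<close>.\<close>
  define N where "N \<rho> t = (if t = 0 then \<rho> else s * e (\<rho> div s) t)" for \<rho> t
  define G where "G \<rho> = (\<Prod>t\<in>T. [:1, W t:] ^ N \<rho> t)" for \<rho>
  have degW: "degree (W t) \<le> k - 1" if "t \<in> T" for t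
    using degree_prod_linear_powers[of "\<lambda>_. 1" "T - {t}"] T(1) that
    by (simp add: W_def k_def card_Diff_singleton)
  have degG: "degree (coeff (G \<rho>) l) \<le> l * (k - 1)" for \<rho> l
    unfolding G_def
    by (intro degree_coeff_prod_le degree_coeff_power_le)
      (use degW in \<open>auto simp: coeff_pCons split: nat.split\<close>)
  \<comment> \<open>As a polynomial in \<open>a\<close>, this is what the coefficient of
    \<open>y^l\<close> in the term \<open>(j, \<rho>)\<close> becomes on \<open>Z\<close>.\<close>
  define B where "B l j \<rho> = monom (\<gamma> (\<rho> div s)) (j + \<rho> mod s) * coeff (G \<rho>) l" for l j \<rho>
  have degB: "degree (B l j \<rho>) < J + s - 1 + l * (k - 1)" if "j < J" for l j \<rho>
  proof -
    have "degree (B l j \<rho>) \<le> (j + \<rho> mod s) + l * (k - 1)"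
      unfolding B_def
      by (intro order.trans[OF degree_mult_le] add_mono degG degree_monom_le)
    moreover have "\<rho> mod s < s" using s by simp
    ultimately show ?thesis using that by linarith
  qed
  \<comment> \<open>The unknowns are the pairs \<open>(j, \<rho>)\<close>. The conditions are the
    coefficients of \<open>M\<close> polynomials in \<open>a\<close>, so their number does not
    depend on how many points \<open>Z\<close> has.\<close>
  define K where "K = {..<J} \<times> {..<q - 1}"
  define C where "C = (SIGMA l:{..<M}. {..<J + s - 1 + l * (k - 1)})"
  have "card C < card K"
    using J by (simp add: C_def K_def k_def)
  then have "\<exists>\<beta>. (\<exists>\<kappa>\<in>K. \<not> z (\<beta> \<kappa>)) \<and>
      (\<forall>c\<in>C. z (\<Sum>\<kappa>\<in>K. \<beta> \<kappa> * coeff (B (fst c) (fst \<kappa>) (snd \<kappa>)) (snd c)))"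
    by (intro small_homogeneous_solution[OF _ _ _ reps]) (auto simp: C_def K_def)
  then obtain \<beta> where \<beta>: "\<exists>\<kappa>\<in>K. \<not> z (\<beta> \<kappa>)"
    "\<And>c. c \<in> C \<Longrightarrow> z (\<Sum>\<kappa>\<in>K. \<beta> \<kappa> * coeff (B (fst c) (fst \<kappa>) (snd \<kappa>)) (snd c))"
    by blast
  have R0: "zp (\<Sum>\<kappa>\<in>K. smult (\<beta> \<kappa>) (B l (fst \<kappa>) (snd \<kappa>)))" if l: "l < M" for l
    unfolding zp_def
  proof
    fix n
    show "z (coeff (\<Sum>\<kappa>\<in>K. smult (\<beta> \<kappa>) (B l (fst \<kappa>) (snd \<kappa>))) n)"
    proof (cases "n < J + s - 1 + l * (k - 1)")
      case True
      then show ?thesis using \<beta>(2)[of "(l, n)"] l by (auto simp: C_def coeff_sum)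
    next
      case False
      then have "coeff (B l (fst \<kappa>) (snd \<kappa>)) n = 0" if "\<kappa> \<in> K" for \<kappa>
        using degB[of "fst \<kappa>" l "snd \<kappa>"] that by (intro coeff_eq_0) (auto simp: K_def)
      then show ?thesis by (simp add: coeff_sum z_0)
    qed
  qed
  define F where "F j \<rho> = [:0, 1:] ^ (q * j) * (\<Prod>t\<in>T. [:- t, 1:] ^ N \<rho> t)" for j \<rho>
  define P where "P = (\<Sum>\<kappa>\<in>K. smult (\<beta> \<kappa>) (F (fst \<kappa>) (snd \<kappa>)))"

  have taylor: "\<exists>Q. zp (P - [:- a, 1:] ^ M * Q)" if a: "a \<in> Z" for a
  proof (rule zlow_taylor_dvd)
    define w where "w = (\<Prod>t\<in>T. a - t)"
    have w: "w = (a - t) * poly (W t) a" if "t \<in> T" for t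
      using that T(1) by (simp add: w_def W_def poly_prod prod.remove[of T t])
    have wz: "\<not> z w"
      using z_prod[of T "\<lambda>t. a - t"] Z(3)[OF a] T(1) by (auto simp: w_def)
    define V where "V \<rho> = eval_coeffs a (G \<rho>)" for \<rho>
    have V: "V \<rho> = (\<Prod>t\<in>T. [:1, poly (W t) a:] ^ N \<rho> t)" for \<rho>
      by (simp add: V_def G_def eval_coeffs_prod eval_coeffs_power map_poly_pCons)
    have F_low: "zlow M (F j \<rho> \<circ>\<^sub>p [:a, w:] - smult (a ^ j * (a ^ (\<rho> mod s) * \<gamma> (\<rho> div s))) (V \<rho>))"
      if "\<rho> < q - 1" for j \<rho>
    proof -
      let ?c = "a ^ (\<rho> mod s) * \<gamma> (\<rho> div s)" and ?y = "[:a, w:]"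
      have "F j \<rho> \<circ>\<^sub>p ?y = ?y ^ (q * j) * (\<Prod>t\<in>T. [:a - t, w:] ^ N \<rho> t)"
        by (simp add: F_def pcompose_mult pcompose_power pcompose_prod pcompose_pCons)
      also have "(\<Prod>t\<in>T. [:a - t, w:] ^ N \<rho> t)
          = (\<Prod>t\<in>T. smult ((a - t) ^ N \<rho> t) ([:1, poly (W t) a:] ^ N \<rho> t))"
        by (intro prod.cong refl) (simp add: w flip: smult_power)
      also have "\<dots> = smult (\<Prod>t\<in>T. (a - t) ^ N \<rho> t) (V \<rho>)"
        by (simp add: V prod_smult)
      finally have F_y: "F j \<rho> \<circ>\<^sub>p ?y = ?y ^ (q * j) * smult (\<Prod>t\<in>T. (a - t) ^ N \<rho> t) (V \<rho>)" .
      have i: "\<rho> div s < d" using idx that .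
      have "(\<Prod>t\<in>T. (a - t) ^ N \<rho> t) = a ^ (\<rho> mod s) * (\<Prod>t\<in>T. (a - t) ^ (s * e (\<rho> div s) t))"
        using T(1,2) i
        by (simp add: prod.remove[of T 0] N_def e(1) mult.assoc flip: power_add)
      then have "z ((\<Prod>t\<in>T. (a - t) ^ N \<rho> t) - ?c)"
        using z_mult_diff[OF _ Z(4)[OF a i], of "a ^ (\<rho> mod s)" "a ^ (\<rho> mod s)"] by (simp add: z_0)
      then have "zlow M (smult (\<Prod>t\<in>T. (a - t) ^ N \<rho> t) (V \<rho>) - smult ?c (V \<rho>))"
        by (simp add: zlow_def z_mult flip: left_diff_distrib)
      moreover have "zlow M (?y ^ (q * j) - [:a ^ j:])"
        by (rule zlow_frobenius_linear[OF char order(1) M order(3)])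
      ultimately have "zlow M (F j \<rho> \<circ>\<^sub>p ?y - [:a ^ j:] * smult ?c (V \<rho>))"
        unfolding F_y by (intro low.z_mult_diff)
      then show ?thesis by (simp add: mult.commute[of _ "a ^ j"])
    qed
    have P_low: "zlow M (P \<circ>\<^sub>p [:a, w:] - (\<Sum>(j, \<rho>)\<in>K.
        smult (\<beta> (j, \<rho>) * (a ^ j * (a ^ (\<rho> mod s) * \<gamma> (\<rho> div s)))) (V \<rho>)))"
      unfolding P_def pcompose_sum
    proof (rule low.z_sum_diff)
      fix \<kappa> assume "\<kappa> \<in> K"
      then obtain j \<rho> where k: "\<kappa> = (j, \<rho>)" "\<rho> < q - 1" by (auto simp: K_def)
      have "zlow M ([:\<beta> \<kappa>:] * (F j \<rho> \<circ>\<^sub>p [:a, w:]) -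
          [:\<beta> \<kappa>:] * smult (a ^ j * (a ^ (\<rho> mod s) * \<gamma> (\<rho> div s))) (V \<rho>))"
        by (intro low.z_mult_diff F_low k) (simp add: low.z_0)
      then show "zlow M (smult (\<beta> \<kappa>) (F (fst \<kappa>) (snd \<kappa>)) \<circ>\<^sub>p [:a, w:] - (case \<kappa> of (j, \<rho>) \<Rightarrow>
          smult (\<beta> (j, \<rho>) * (a ^ j * (a ^ (\<rho> mod s) * \<gamma> (\<rho> div s)))) (V \<rho>)))"
        by (simp add: k pcompose_smult mult.commute[of "\<beta> (j, \<rho>)"])
    qed
    show "zlow M (P \<circ>\<^sub>p [:a, 1:])"
      unfolding zlow_def
    proof (intro allI impI)
      fix l assume l: "l < M"
      let ?S = "\<Sum>(j, \<rho>)\<in>K.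
        smult (\<beta> (j, \<rho>) * (a ^ j * (a ^ (\<rho> mod s) * \<gamma> (\<rho> div s)))) (V \<rho>)"
      have "coeff ?S l = poly (\<Sum>\<kappa>\<in>K. smult (\<beta> \<kappa>) (B l (fst \<kappa>) (snd \<kappa>))) a"
        unfolding coeff_sum poly_sum
        by (intro sum.cong refl)
          (simp add: B_def V_def coeff_map_poly poly_monom power_add case_prod_beta mult_ac)
      then have "z (coeff ?S l)" using zp_poly[OF R0[OF l]] by simp
      moreover have "z (coeff (P \<circ>\<^sub>p [:a, w:]) l - coeff ?S l)"
        using P_low l by (simp add: zlow_def)
      ultimately have "z (coeff (P \<circ>\<^sub>p [:a, w:]) l)" using z_cong by blast
      \<comment> \<open>Along \<open>w y\<close> the Taylor coefficient of order \<open>l\<close> is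
        multiplied by \<open>w^l\<close>, and \<open>w\<close> lies outside the ideal.\<close>
      moreover have "P \<circ>\<^sub>p [:a, w:] = (P \<circ>\<^sub>p [:a, 1:]) \<circ>\<^sub>p [:0, w:]"
        by (simp flip: pcompose_assoc add: pcompose_pCons)
      ultimately have "z (w ^ l * coeff (P \<circ>\<^sub>p [:a, 1:]) l)"
        by (simp add: coeff_pcompose_linear)
      then show "z (coeff (P \<circ>\<^sub>p [:a, 1:]) l)"
        using wz z_power z_mult_iff by blast
    qed
  qed

  define H where "H \<rho> = (\<Prod>t\<in>T - {0}. [:- t, 1:] ^ N \<rho> t)" for \<rho>
  have F_H: "F j \<rho> = monom 1 (q * j + \<rho>) * H \<rho>" for j \<rho>
    using T(1,2) by (simp add: F_def H_def prod.remove[of T 0] N_def monom_altdef power_add mult.assoc)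
  have "\<not> zp P"
  proof -
    \<comment> \<open>Among the terms with coefficient outside the ideal, the one of least order
      \<open>q j + \<rho>\<close> at 0 alone decides the coefficient of \<open>P\<close> in that
      degree.\<close>
    let ?ex = "\<lambda>\<kappa>. q * fst \<kappa> + snd \<kappa>"
    obtain \<kappa> where \<kappa>: "\<kappa> \<in> K" "\<not> z (\<beta> \<kappa>)"
      and min: "\<And>\<kappa>'. \<kappa>' \<in> K \<Longrightarrow> \<not> z (\<beta> \<kappa>') \<Longrightarrow> ?ex \<kappa> \<le> ?ex \<kappa>'"
      using ex_has_least_nat[of "\<lambda>\<kappa>. \<kappa> \<in> K \<and> \<not> z (\<beta> \<kappa>)" _ ?ex] \<beta>(1) by blast
    have inj: "\<kappa>' = \<kappa>" if "\<kappa>' \<in> K" "?ex \<kappa>' = ?ex \<kappa>" for \<kappa>'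
    proof -
      have "snd \<kappa>' < q" "snd \<kappa> < q" using that \<kappa> by (auto simp: K_def)
      then have "snd \<kappa>' = snd \<kappa>" using arg_cong[OF that(2), of "\<lambda>x. x mod q"] by simp
      with that(2) order(2) show ?thesis by (auto simp: prod_eq_iff)
    qed
    have other: "z (\<beta> \<kappa>' * coeff (F (fst \<kappa>') (snd \<kappa>')) (?ex \<kappa>))" if "\<kappa>' \<in> K - {\<kappa>}" for \<kappa>'
    proof (cases "z (\<beta> \<kappa>')")
      case False
      have "?ex \<kappa>' \<noteq> ?ex \<kappa>" using inj[of \<kappa>'] that by blast
      moreover have "?ex \<kappa> \<le> ?ex \<kappa>'" using min[of \<kappa>'] that False by blast
      ultimately have "?ex \<kappa> < ?ex \<kappa>'" by simp
      then show ?thesis by (simp add: F_H coeff_monom_mult z_0)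
    qed (rule z_mult)
    have "coeff P (?ex \<kappa>) = \<beta> \<kappa> * coeff (F (fst \<kappa>) (snd \<kappa>)) (?ex \<kappa>)
        + (\<Sum>\<kappa>'\<in>K - {\<kappa>}. \<beta> \<kappa>' * coeff (F (fst \<kappa>') (snd \<kappa>')) (?ex \<kappa>))"
      unfolding P_def coeff_sum coeff_smult
      by (rule sum.remove[OF _ \<kappa>(1)]) (simp add: K_def)
    moreover have "z (\<Sum>\<kappa>'\<in>K - {\<kappa>}. \<beta> \<kappa>' * coeff (F (fst \<kappa>') (snd \<kappa>')) (?ex \<kappa>))"
      by (rule z_sum) (rule other)
    moreover have "\<not> z (\<beta> \<kappa> * coeff (F (fst \<kappa>) (snd \<kappa>)) (?ex \<kappa>))"
    proof -
      have "coeff (F (fst \<kappa>) (snd \<kappa>)) (?ex \<kappa>) = poly (H (snd \<kappa>)) 0"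
        by (simp add: F_H coeff_monom_mult poly_0_coeff_0)
      also have "\<dots> = (\<Prod>t\<in>T - {0}. (- t) ^ N (snd \<kappa>) t)" by (simp add: H_def poly_prod)
      finally have "\<not> z (coeff (F (fst \<kappa>) (snd \<kappa>)) (?ex \<kappa>))"
        using z_prod[of "T - {0}" "\<lambda>t. (- t) ^ N (snd \<kappa>) t"] z_power z_minus T
        by fastforce
      then show ?thesis using \<kappa>(2) z_mult_iff by blast
    qed
    ultimately have "\<not> z (coeff P (?ex \<kappa>))" by (simp add: z_add_iff)
    then show ?thesis by (auto simp: zp_def)
  qed
  moreover obtain Q where "zp (P - (\<Prod>a\<in>Z. [:- a, 1:] ^ M) * Q)"
    using zp_dvd_prod[OF Z(1,2) taylor] by blast
  moreover have "lead_coeff (\<Prod>a\<in>Z. [:- a, 1:] ^ M) = 1"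
    by (simp add: lead_coeff_prod lead_coeff_power)
  ultimately have "degree (\<Prod>a\<in>Z. [:- a, 1:] ^ M) \<le> degree P"
    by (rule degree_ge_of_monic_dvd)
  then have "M * card Z \<le> degree P"
    by (simp add: degree_prod_linear_powers mult.commute)
  also have "degree P \<le> q * (J - 1) + (q - 2) + (k - 1) * ((d - 1) * s)"
    unfolding P_def
  proof (rule degree_sum_le)
    fix \<kappa> assume "\<kappa> \<in> K"
    then have k: "fst \<kappa> \<le> J - 1" "snd \<kappa> < q - 1" by (auto simp: K_def)
    have "degree (H (snd \<kappa>)) = (\<Sum>t\<in>T - {0}. N (snd \<kappa>) t)"
      by (simp add: H_def degree_prod_linear_powers)
    also have "\<dots> \<le> of_nat (card (T - {0})) * ((d - 1) * s)"
    proof (rule sum_bounded_above)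
      fix t assume "t \<in> T - {0}"
      then have "e (snd \<kappa> div s) t \<le> d - 1" using e(2)[OF idx[OF k(2)], of t] by auto
      then show "N (snd \<kappa>) t \<le> (d - 1) * s" using \<open>t \<in> T - {0}\<close> by (simp add: N_def)
    qed
    also have "card (T - {0}) = k - 1" using T by (simp add: k_def)
    finally have "degree (H (snd \<kappa>)) \<le> (k - 1) * ((d - 1) * s)" by simp
    moreover have "q * fst \<kappa> \<le> q * (J - 1)" using k by simp
    moreover have "degree (F (fst \<kappa>) (snd \<kappa>)) \<le> (q * fst \<kappa> + snd \<kappa>) + degree (H (snd \<kappa>))"
      unfolding F_H by (intro order.trans[OF degree_mult_le] add_mono degree_monom_le order.refl)
    moreover have "snd \<kappa> \<le> q - 2" using k by simp
    ultimately show "degree (smult (\<beta> \<kappa>) (F (fst \<kappa>) (snd \<kappa>)))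
        \<le> q * (J - 1) + (q - 2) + (k - 1) * ((d - 1) * s)"
      using degree_smult_le[of "\<beta> \<kappa>" "F (fst \<kappa>) (snd \<kappa>)"] by linarith
  qed (simp add: K_def)
  finally show ?thesis by (simp add: k_def mult.assoc)
qed

text \<open>The error is about \<open>k (M / 2 + q / M)\<close>: the first part comes from the
  number of conditions, the second from dividing the degree by the order \<open>M\<close> of
  vanishing. For \<open>M\<close> near \<open>sqrt q\<close> this is \<open>3 / 2 k sqrt q\<close>;
  the constant \<open>8 / 5\<close> covers the rounding once \<open>q \<ge> 256\<close>.\<close>

lemma stepanov_optimize:
  fixes q d s k N :: nat
  assumes q: "q \<ge> 256" and d: "d * s = q - 1" "d \<ge> 2" and k: "k \<ge> 1"
    and bound: "\<And>M J. M \<le> q \<Longrightarrow> (\<Sum>l<M. J + s - 1 + l * (k - 1)) < J * (q - 1) \<Longrightarrow>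
      M * N \<le> q * (J - 1) + (q - 2) + (k - 1) * (d - 1) * s"
  shows "real N \<le> real q / real d + 8 / 5 * real k * sqrt (real q)"
proof -
  define w where "w = sqrt (real q)"
  define M where "M = nat \<lfloor>w\<rfloor>"
  have "sqrt 256 \<le> w" unfolding w_def using q by (intro real_sqrt_le_mono) simp
  then have w16: "w \<ge> 16" using real_sqrt_pow2[of 16] by (simp add: real_sqrt_unique[of 16])
  have w2: "w * w = real q" by (simp add: w_def)
  have Mw: "real M \<le> w" "w < real M + 1" using w16 by (simp_all add: M_def)
  then have M16: "M \<ge> 16" using w16 by (simp add: M_def le_nat_iff le_floor_iff)
  have sum_eq: "2 * (\<Sum>l<m. c + l * b) = 2 * m * c + b * (m * (m - 1))" for m c b :: nat
  proof (induction m)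
    case (Suc m)
    then show ?case by (cases m) (simp_all add: algebra_simps)
  qed simp
  have s0: "s > 0" using d(1) q by (auto intro!: gr0I)
  \<comment> \<open>Of the \<open>J (q - 1)\<close> unknowns, \<open>J M\<close> are consumed by the
    summand \<open>J\<close> in each of the \<open>M\<close> levels of conditions; \<open>D\<close>
    is the net gain per unit of \<open>J\<close>.\<close>
  define D where "D = real q - 1 - real M"
  have Mq: "real M * real M \<le> real q" using Mw w16 mult_mono[OF Mw(1) Mw(1)] w2 by simp
  \<comment> \<open>\<open>M^2 / (M + 1)\<close> increases and is \<open>256 / 17 > 15.058\<close>
    at \<open>M = 16\<close>; hence
    \<open>q / D \<le> 15.058 / 14.058 < 1339 / 1250\<close>.\<close>
  have "15.058 * (real M + 1) \<le> real M * real M"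
  proof -
    have "0 \<le> (real M - 16) * (1000 * real M + 942)" using M16 by simp
    also have "\<dots> = 1000 * (real M * real M) - 15058 * real M - 15072" by (simp add: algebra_simps)
    finally show ?thesis by simp
  qed
  then have D: "real q \<le> 1339 / 1250 * D" using Mq by (simp add: D_def)
  then have D0: "D > 0" using q by simp
  define X where "X = real M * real s + real (k - 1) * (real M * (real M - 1)) / 2"
  have X0: "X \<ge> 0" using M16 by (simp add: X_def)
  \<comment> \<open>the least \<open>J\<close> with \<open>X < J D\<close>, which leaves more unknowns than conditions\<close>
  define J where "J = nat \<lfloor>X / D\<rfloor> + 1"
  have fl: "0 \<le> \<lfloor>X / D\<rfloor>" using X0 D0 by simp
  have J1: "X / D < real J" and J2: "real J \<le> X / D + 1"
    using fl by (simp_all add: J_def, linarith+)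
  have "X < real J * D" using J1 D0 by (simp add: field_simps)
  have "real (2 * (\<Sum>l<M. J + s - 1 + l * (k - 1)))
      = 2 * real M * real (J + s - 1) + real (k - 1) * (real M * (real M - 1))"
    unfolding sum_eq using M16 by (simp add: of_nat_diff)
  also have "real (J + s - 1) = real J + real s - 1" using s0 by (simp add: of_nat_diff)
  also have "2 * real M * (real J + real s - 1) + real (k - 1) * (real M * (real M - 1))
      = 2 * X + 2 * real M * real J - 2 * real M"
    by (simp add: X_def field_simps)
  also have "\<dots> < 2 * (real J * D) + 2 * real M * real J"
    using \<open>X < real J * D\<close> M16 by simp
  also have "\<dots> = real (2 * (J * (q - 1)))"
    using q by (simp add: D_def algebra_simps of_nat_diff)
  finally have "(\<Sum>l<M. J + s - 1 + l * (k - 1)) < J * (q - 1)"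
    using of_nat_less_iff[where 'a=real] by fastforce
  moreover have "M \<le> q"
  proof -
    have "real M * 1 \<le> real M * real M" using M16 by (intro mult_left_mono) auto
    then show ?thesis using Mq by simp
  qed
  ultimately have "M * N \<le> q * (J - 1) + (q - 2) + (k - 1) * (d - 1) * s" by (intro bound)
  also have "\<dots> \<le> q * (J - 1) + q + (k - 1) * q"
  proof -
    have "(d - 1) * s \<le> q" using d by (simp add: diff_mult_distrib)
    then have "(k - 1) * ((d - 1) * s) \<le> (k - 1) * q" by (rule mult_left_mono) simp
    then show ?thesis by (simp only: mult.assoc)
  qed
  also have "\<dots> = q * (J - 1) + k * q" using k by (cases k) auto
  finally have "real (M * N) \<le> real (q * (J - 1) + k * q)" by (simp only: of_nat_le_iff)
  then have "real M * real N \<le> real q * (real J - 1) + real k * real q"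
    by (simp add: J_def)
  also have "\<dots> \<le> real q * (X / D) + real k * real q"
    using J2 by (intro add_right_mono mult_left_mono) auto
  finally have "real N \<le> (real q * (X / D) + real k * real q) / real M"
    using M16 by (simp add: pos_le_divide_eq mult.commute)
  also have "\<dots> = real q / D * (real s + real (k - 1) * (real M - 1) / 2) + real k * (real q / real M)"
    using M16 D0 by (simp add: X_def field_simps)
  also have "\<dots> \<le> (real q / real d + real q / D * (real M / 2))
      + real q / D * (real (k - 1) * real M / 2) + real k * (real q / real M)"
  proof -
    have "real d * real s = real q - 1"
      using d(1) q by (metis of_nat_mult of_nat_diff of_nat_1 le_trans numeral_le_iff one_le_numeral)
    then have s: "real s = (real q - 1) / real d" using d(2) by (simp add: field_simps)
    have "real q / D * real s = real q / real d + real q / D * (real M / real d)"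
      unfolding s using D0 d(2) by (simp add: field_simps) (simp add: D_def algebra_simps)
    also have "\<dots> \<le> real q / real d + real q / D * (real M / 2)"
      using d(2) D0 by (intro add_left_mono mult_left_mono divide_left_mono) auto
    finally have "real q / D * real s \<le> real q / real d + real q / D * (real M / 2)" .
    moreover have "real q / D * (real (k - 1) * (real M - 1) / 2) \<le> real q / D * (real (k - 1) * real M / 2)"
      using D0 by (intro mult_left_mono divide_right_mono) auto
    ultimately show ?thesis by (simp add: distrib_left)
  qed
  also have "\<dots> = real q / real d + real k * (real q / D * (real M / 2) + real q / real M)"
    using k D0 M16 by (simp add: of_nat_diff field_simps)
  also have "\<dots> \<le> real q / real d + real k * (8 / 5 * w)"
  proof (intro add_left_mono mult_left_mono)
    have "real q / D \<le> 1339 / 1250" using D D0 by (simp add: pos_divide_le_eq)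
    then have "real q / D * (real M / 2) \<le> 1339 / 1250 * (w / 2)"
      using Mw M16 D0 by (intro mult_mono) auto
    moreover have "w \<le> 17 / 16 * real M" using Mw M16 by simp
    then have "w * w \<le> 17 / 16 * real M * w" using w16 by (intro mult_right_mono) auto
    then have "real q / real M \<le> 17 / 16 * w" using M16 by (simp add: w2 pos_divide_le_eq algebra_simps)
    ultimately show "real q / D * (real M / 2) + real q / real M \<le> 8 / 5 * w"
      using w16 by linarith
  qed simp
  finally show ?thesis by (simp add: w_def)
qed

text \<open>A translation moves the distinguished point \<open>t0\<close> to 0, where
  \<open>stepanov_bound\<close> compares orders of vanishing.\<close>

lemma (in residue_field_pred) stepanov_sqrt:
  fixes T Z :: "'r set" and e :: "nat \<Rightarrow> 'r \<Rightarrow> nat" and \<gamma> :: "nat \<Rightarrow> 'r"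
  assumes q: "q \<ge> 256" and d: "d * s = q - 1" "d \<ge> 2"
    and T: "finite T" "t0 \<in> T" "\<And>t. t \<in> T \<Longrightarrow> t \<noteq> t0 \<Longrightarrow> \<not> z (t - t0)"
    and e: "\<And>i. i < d \<Longrightarrow> e i t0 = i" "\<And>i t. i < d \<Longrightarrow> t \<in> T \<Longrightarrow> e i t < d"
    and Z: "finite Z" "\<And>a b. a \<in> Z \<Longrightarrow> b \<in> Z \<Longrightarrow> a \<noteq> b \<Longrightarrow> \<not> z (a - b)"
      "\<And>a t. a \<in> Z \<Longrightarrow> t \<in> T \<Longrightarrow> \<not> z (a - t)"
      "\<And>a i. a \<in> Z \<Longrightarrow> i < d \<Longrightarrow> z ((\<Prod>t\<in>T. (a - t) ^ (s * e i t)) - \<gamma> i)"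
  shows "real (card Z) \<le> real q / real d + 8 / 5 * real (card T) * sqrt (real q)"
proof (rule stepanov_optimize[OF q d])
  show "1 \<le> card T" using T by (metis card_gt_0_iff empty_iff less_eq_Suc_le One_nat_def)
next
  fix M J assume MJ: "M \<le> q" "(\<Sum>l<M. J + s - 1 + l * (card T - 1)) < J * (q - 1)"
  define g where "g = (\<lambda>a. a - t0)"
  have inj: "inj_on g A" for A by (auto simp: g_def inj_on_def)
  have "M * card (g ` Z) \<le> q * (J - 1) + (q - 2) + (card (g ` T) - 1) * (d - 1) * s"
  proof (rule stepanov_bound[OF d(1), where e = "\<lambda>i t. e i (t + t0)" and \<gamma> = \<gamma>])
    fix a i assume a: "a \<in> g ` Z" and i: "i < d"
    then obtain b where b: "b \<in> Z" "a = b - t0" by (auto simp: g_def)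
    have "(\<Prod>t\<in>g ` T. (a - t) ^ (s * e i (t + t0))) = (\<Prod>t\<in>T. (b - t) ^ (s * e i t))"
      by (subst prod.reindex[OF inj]) (simp add: b g_def)
    then show "z ((\<Prod>t\<in>g ` T. (a - t) ^ (s * e i (t + t0))) - \<gamma> i)" using Z(4)[OF b(1) i] by simp
  qed (use T e Z MJ card_image[OF inj] in \<open>auto simp: g_def\<close>)
  then show "M * card Z \<le> q * (J - 1) + (q - 2) + (card T - 1) * (d - 1) * s"
    by (simp add: card_image[OF inj])
qed

section \<open>Patterns of quadratic residues\<close>

lemma residue_field_int:
  fixes p :: nat
  assumes p: "prime p"
  shows "residue_field_pred (\<lambda>x::int. int p dvd x) {0..<int p} (\<lambda>x. x mod int p) p 1 p"
proof unfold_locales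
  have pi: "prime (int p)" using p by simp
  show "int p dvd a \<or> int p dvd b" if "int p dvd a * b" for a b
    using that pi prime_dvd_mult_iff by blast
  show "\<not> int p dvd 1" using p by (auto simp: prime_nat_iff)
  show "x mod int p \<in> {0..<int p}" for x using p by (simp add: prime_gt_0_nat)
  show "\<not> int p dvd (x - y)" if "x \<in> {0..<int p}" "y \<in> {0..<int p}" "x \<noteq> y" for x y
    using that by (metis atLeastLessThan_iff mod_eq_dvd_iff mod_pos_pos_trivial)
  show "int p dvd (a ^ p - a)" for a
  proof -
    define b where "b = nat (a mod int p)"
    have b: "int b = a mod int p" using p by (simp add: b_def prime_gt_0_nat)
    have "[b ^ p = b] (mod p)"
    proof (cases "p dvd b")
      case True
      then show ?thesis using p by (simp add: cong_def dvd_imp_mod_0 power_mod prime_gt_0_nat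
            dvd_power dvd_trans[OF True dvd_power])
    next
      case False
      from fermat_theorem[OF p this] have "[b ^ (p - 1) * b = 1 * b] (mod p)"
        by (rule cong_scalar_right)
      then show ?thesis using p by (simp add: power_eq_if prime_gt_0_nat mult.commute)
    qed
    then have "[int b ^ p = int b] (mod int p)" by (metis cong_int_iff of_nat_power)
    moreover have "[a = int b] (mod int p)" by (simp add: b)
    ultimately have "[a ^ p = a] (mod int p)"
      by (meson cong_pow cong_sym cong_trans)
    then show ?thesis by (simp add: cong_iff_dvd_diff)
  qed
qed (use p prime_gt_1_nat[OF p] in \<open>auto simp: minus_mod_eq_mult_div\<close>)

lemma Legendre_values: "Legendre a p \<in> {-1, 0, 1}"
  by (simp add: Legendre_def)

lemma Legendre_eq_0_iff: "Legendre a p = 0 \<longleftrightarrow> p dvd a"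
  by (simp add: Legendre_def cong_0_iff)

lemma prod_Legendre_values: "(\<Prod>i\<in>S. Legendre (f i) p) \<in> {-1, 0, 1}"
  by (induction S rule: infinite_finite_induct) (use Legendre_values in \<open>auto, fastforce+\<close>)

lemma sum_card_Pow: "finite A \<Longrightarrow> 2 * (\<Sum>S\<in>Pow A. card S) = card A * 2 ^ card A"
proof (induction A rule: finite_induct)
  case (insert x A)
  have "(\<Sum>S\<in>Pow (insert x A). card S) = (\<Sum>S\<in>Pow A. card S) + (\<Sum>S\<in>insert x ` Pow A. card S)"
    using insert by (simp add: Pow_insert sum.union_disjoint disjoint_iff image_iff) 
      (subst sum.union_disjoint, auto)
  also have "(\<Sum>S\<in>insert x ` Pow A. card S) = (\<Sum>S\<in>Pow A. card (insert x S))"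
    using insert by (subst sum.reindex) (auto simp: inj_on_def)
  also have "\<dots> = (\<Sum>S\<in>Pow A. card S + 1)"
    using insert by (intro sum.cong refl) (auto simp: card_insert_if finite_subset)
  finally show ?case using insert by (simp add: sum.distrib card_Pow sum_Suc)
qed simp

context
  fixes p :: nat
  assumes p: "prime p" "p \<ge> 256"
begin

lemma odd_prime_ge_256: "odd p"
  using p prime_odd_nat by force

text \<open>Euler's criterion replaces each symbol by a power with exponent
  \<open>(p - 1) div 2\<close>, which is Stepanov's bound for \<open>d = 2\<close> with all
  exponents \<open>e i t = i\<close>.\<close>

lemma card_prod_Legendre_le:
  fixes b :: "'i \<Rightarrow> int" and \<delta> :: int
  assumes S: "finite S" "S \<noteq> {}"
    and b: "\<And>i j. i \<in> S \<Longrightarrow> j \<in> S \<Longrightarrow> i \<noteq> j \<Longrightarrow> \<not> int p dvd (b i - b j)"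
    and \<delta>: "\<delta> \<noteq> 0"
  shows "real (card {y \<in> {0..<int p}. (\<Prod>i\<in>S. Legendre (y + b i) (int p)) = \<delta>})
    \<le> real p / 2 + 8 / 5 * real (card S) * sqrt (real p)"
proof -
  interpret residue_field_pred "\<lambda>x::int. int p dvd x" "{0..<int p}" "\<lambda>x. x mod int p" p 1 p
    by (rule residue_field_int) (fact p)
  obtain i0 where i0: "i0 \<in> S" using S by auto
  define h where "h = (\<lambda>i. - b i)"
  have inj: "inj_on h S"
    using b by (auto simp: h_def inj_on_def) (metis cancel_comm_monoid_add_class.diff_cancel dvd_0_right)
  let ?Z = "{y \<in> {0..<int p}. (\<Prod>i\<in>S. Legendre (y + b i) (int p)) = \<delta>}"
  have nz: "\<not> int p dvd (a + b i)" if "a \<in> ?Z" "i \<in> S" for a i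
  proof
    assume "int p dvd (a + b i)"
    then have "(\<Prod>i\<in>S. Legendre (a + b i) (int p)) = 0"
      using that S by (auto simp: Legendre_eq_0_iff)
    with that \<delta> show False by auto
  qed
  have euler: "int p dvd ((\<Prod>i\<in>S. (a + b i) ^ ((p - 1) div 2)) - (\<Prod>i\<in>S. Legendre (a + b i) (int p)))" for a
  proof (rule z_prod_diff)
    fix i
    show "int p dvd ((a + b i) ^ ((p - 1) div 2) - Legendre (a + b i) (int p))"
      using euler_criterion[of p "a + b i"] p by (simp add: cong_iff_dvd_diff dvd_diff_commute)
  qed
  have finZ: "finite ?Z" by (rule finite_subset[OF _ finite_atLeastLessThan_int]) auto
  have sep: "\<not> int p dvd t - h i0" if t: "t \<in> h ` S" "t \<noteq> h i0" for t
  proof -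
    from t obtain j where "j \<in> S" "t = - b j" "j \<noteq> i0" by (auto simp: h_def)
    then show ?thesis using b[of i0 j] i0 by (simp add: h_def)
  qed
  have "real (card ?Z) \<le> real p / real 2 + 8 / 5 * real (card (h ` S)) * sqrt (real p)"
  proof (rule stepanov_sqrt[where s = "(p - 1) div 2" and e = "\<lambda>i _. i" and \<gamma> = "\<lambda>i. \<delta> ^ i" and ?t0.0 = "h i0"])
    show "2 * ((p - 1) div 2) = p - 1" using odd_prime_ge_256 by simp
    fix a i assume a: "a \<in> ?Z" and "i < (2::nat)"
    have "(\<Prod>t\<in>h ` S. (a - t) ^ ((p - 1) div 2 * i)) = (\<Prod>j\<in>S. (a + b j) ^ ((p - 1) div 2)) ^ i"
      by (subst prod.reindex[OF inj]) (simp add: h_def power_mult prod_power_distrib)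
    then show "int p dvd ((\<Prod>t\<in>h ` S. (a - t) ^ ((p - 1) div 2 * i)) - \<delta> ^ i)"
      using z_power_diff[OF euler, of a i] a by simp
  next
    fix a b assume "a \<in> ?Z" "b \<in> ?Z" "a \<noteq> b"
    then show "\<not> int p dvd a - b" by (intro reps) auto
  qed (use S p i0 sep nz finZ in \<open>auto simp: h_def\<close>)
  then show ?thesis by (simp add: card_image[OF inj])
qed

text \<open>Stepanov bounds the two classes only from above. They fill the \<open>p\<close> residues
  up to at most \<open>card S\<close> zeros, so a deficit of one class is an excess of the other;
  this doubles \<open>8 / 5\<close> and adds the 1.\<close>

lemma abs_sum_prod_Legendre_le:
  fixes b :: "'i \<Rightarrow> int"
  assumes S: "finite S" "S \<noteq> {}"
    and b: "\<And>i j. i \<in> S \<Longrightarrow> j \<in> S \<Longrightarrow> i \<noteq> j \<Longrightarrow> \<not> int p dvd (b i - b j)"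
  shows "\<bar>real_of_int (\<Sum>y\<in>{0..<int p}. \<Prod>i\<in>S. Legendre (y + b i) (int p))\<bar>
    \<le> real (card S) * (16 / 5 * sqrt (real p) + 1)"
proof -
  define c where "c y = (\<Prod>i\<in>S. Legendre (y + b i) (int p))" for y
  define Z where "Z \<delta> = {y \<in> {0..<int p}. c y = \<delta>}" for \<delta>
  have fin: "finite (Z \<delta>)" for \<delta> unfolding Z_def by (rule finite_subset[OF _ finite_atLeastLessThan_int]) auto
  have val: "c y \<in> {-1, 0, 1}" for y unfolding c_def by (rule prod_Legendre_values)
  have UN: "{0..<int p} = Z (-1) \<union> Z 0 \<union> Z 1" using val by (auto simp: Z_def)
  have disj: "Z (-1) \<inter> Z 0 = {}" "(Z (-1) \<union> Z 0) \<inter> Z 1 = {}" by (auto simp: Z_def)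
  have sm: "(\<Sum>y\<in>{0..<int p}. h y) = (\<Sum>y\<in>Z (-1). h y) + (\<Sum>y\<in>Z 0. h y) + (\<Sum>y\<in>Z 1. h y)" for h :: "int \<Rightarrow> int"
    unfolding UN using fin disj by (simp add: sum.union_disjoint)
  have "(\<Sum>y\<in>{0..<int p}. c y) = int (card (Z 1)) - int (card (Z (-1)))"
    unfolding sm by (simp add: Z_def)
  then have eq: "real_of_int (\<Sum>y\<in>{0..<int p}. c y) = real (card (Z 1)) - real (card (Z (-1)))"
    by simp
  have "int p = int (card (Z (-1))) + int (card (Z 0)) + int (card (Z 1))"
    using sm[of "\<lambda>_. 1"] by simp
  then have tot: "real p = real (card (Z (-1))) + real (card (Z 0)) + real (card (Z 1))"
    by linarith
  have Z0: "card (Z 0) \<le> card S"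
  proof -
    have "Z 0 \<subseteq> (\<lambda>i. (- b i) mod int p) ` S"
    proof
      fix y assume "y \<in> Z 0"
      then obtain i where i: "i \<in> S" "int p dvd y + b i" and y: "y \<in> {0..<int p}"
        using S(1) by (auto simp: Z_def c_def Legendre_eq_0_iff)
      then have "y = (- b i) mod int p"
        by (metis atLeastLessThan_iff diff_minus_eq_add mod_eq_dvd_iff mod_pos_pos_trivial)
      then show "y \<in> (\<lambda>i. (- b i) mod int p) ` S" using i by blast
    qed
    then show ?thesis using surj_card_le[OF S(1)] by blast
  qed
  define K where "K = real (card S) * sqrt (real p)"
  have Z_le: "real (card (Z \<delta>)) \<le> real p / 2 + 8 / 5 * K" if "\<delta> \<noteq> 0" for \<delta>
    using card_prod_Legendre_le[where b = b, OF S b that] by (simp add: Z_def c_def K_def)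
  have "\<bar>real (card (Z 1)) - real (card (Z (-1)))\<bar> \<le> 16 / 5 * K + real (card S)"
    using Z_le[of 1] Z_le[of "-1"] Z0 tot by linarith
  then show ?thesis unfolding c_def[symmetric] eq by (simp add: K_def algebra_simps)
qed

text \<open>The product \<open>F\<close> vanishes off the pattern, except at the at most
  \<open>k\<close> zeros of the linear factors, and never exceeds \<open>2^k\<close>. In its
  expansion the bounds are weighted by \<open>card S\<close>, whose average \<open>k / 2\<close>
  turns \<open>16 / 5\<close> into \<open>8 / 5\<close>; of the \<open>3 / 2\<close>, the part
  \<open>1 / 2\<close> comes from the character sums and 1 from the zeros.\<close>

lemma Legendre_pattern_count:
  fixes b :: "'i \<Rightarrow> int" and \<epsilon> :: "'i \<Rightarrow> int"
  assumes A: "finite A"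
    and b: "\<And>i j. i \<in> A \<Longrightarrow> j \<in> A \<Longrightarrow> i \<noteq> j \<Longrightarrow> \<not> int p dvd (b i - b j)"
    and \<epsilon>: "\<And>i. i \<in> A \<Longrightarrow> \<epsilon> i \<in> {-1, 1}"
  shows "real p / 2 ^ card A - real (card A) * (8 / 5 * sqrt (real p) + 3 / 2)
    \<le> real (card {y \<in> {0..<int p}. \<forall>i\<in>A. Legendre (y + b i) (int p) = \<epsilon> i})"
proof -
  define k where "k = card A"
  let ?Y = "{0..<int p}"
  let ?L = "\<lambda>y i. Legendre (y + b i) (int p)"
  define G where "G = {y \<in> ?Y. \<forall>i\<in>A. ?L y i = \<epsilon> i}"
  define B where "B = {y \<in> ?Y. \<exists>i\<in>A. int p dvd y + b i}"
  define w where "w = sqrt (real p)"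
  have fin: "finite G" "finite B" by (auto simp: G_def B_def intro!: finite_subset[OF _ finite_atLeastLessThan_int])
  have cB: "card B \<le> k"
  proof -
    have "B \<subseteq> (\<lambda>i. (- b i) mod int p) ` A"
    proof
      fix y assume "y \<in> B"
      then obtain i where i: "i \<in> A" "int p dvd y + b i" and y: "y \<in> {0..<int p}"
        by (auto simp: B_def)
      then have "y = (- b i) mod int p"
        by (metis atLeastLessThan_iff diff_minus_eq_add mod_eq_dvd_iff mod_pos_pos_trivial)
      then show "y \<in> (\<lambda>i. (- b i) mod int p) ` A" using i by blast
    qed
    then show ?thesis unfolding k_def using surj_card_le[OF A] by blast
  qed
  define F where "F y = (\<Prod>i\<in>A. \<epsilon> i * ?L y i + 1)" for y
  have "(\<Sum>y\<in>?Y. F y) \<le> 2 ^ k * (int (card G) + int (card B))"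
  proof -
    have le: "0 \<le> \<epsilon> i * ?L y i + 1 \<and> \<epsilon> i * ?L y i + 1 \<le> 2" if "i \<in> A" for y i
      using \<epsilon>[OF that] Legendre_values[of "y + b i" "int p"] by auto
    have "F y \<le> (if y \<in> G \<union> B then 2 ^ k else 0)" if y: "y \<in> ?Y" for y
    proof (cases "y \<in> G \<union> B")
      case True
      have "F y \<le> (\<Prod>i\<in>A. 2)" unfolding F_def using le by (intro prod_mono) auto
      then show ?thesis using True by (simp add: k_def)
    next
      case False
      then obtain i where i: "i \<in> A" "?L y i \<noteq> \<epsilon> i" using y by (auto simp: G_def)
      have "\<not> int p dvd y + b i" using False y i by (auto simp: B_def)
      then have "?L y i \<noteq> 0" by (simp add: Legendre_eq_0_iff)
      then have "\<epsilon> i * ?L y i + 1 = 0"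
        using i \<epsilon>[OF i(1)] Legendre_values[of "y + b i" "int p"] by auto
      then have "F y = 0" unfolding F_def using A i by (metis prod_zero_iff)
      then show ?thesis using False by simp
    qed
    then have "(\<Sum>y\<in>?Y. F y) \<le> (\<Sum>y\<in>?Y. if y \<in> G \<union> B then 2 ^ k else 0)" by (rule sum_mono)
    also have "\<dots> = (\<Sum>y\<in>G \<union> B. 2 ^ k)"
      by (intro sum.mono_neutral_cong_right) (auto simp: G_def B_def)
    also have "\<dots> \<le> 2 ^ k * (int (card G) + int (card B))"
      using card_Un_le[of G B] by (simp add: mult.commute flip: of_nat_add)
    finally show ?thesis .
  qed
  then have upper: "real_of_int (\<Sum>y\<in>?Y. F y) \<le> 2 ^ k * (real (card G) + real k)"
  proof -
    assume "(\<Sum>y\<in>?Y. F y) \<le> 2 ^ k * (int (card G) + int (card B))"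
    then have "real_of_int (\<Sum>y\<in>?Y. F y) \<le> real_of_int (2 ^ k * (int (card G) + int (card B)))"
      by (simp only: of_int_le_iff)
    also have "\<dots> \<le> 2 ^ k * (real (card G) + real k)" using cB by simp
    finally show ?thesis .
  qed
  define E where "E S = (\<Prod>i\<in>S. \<epsilon> i)" for S
  define c where "c S = (\<Sum>y\<in>?Y. \<Prod>i\<in>S. ?L y i)" for S
  have "(\<Sum>y\<in>?Y. F y) = (\<Sum>y\<in>?Y. \<Sum>S\<in>Pow A. E S * (\<Prod>i\<in>S. ?L y i))"
    unfolding F_def by (subst prod_add[OF A]) (simp add: prod.distrib E_def)
  also have "\<dots> = (\<Sum>S\<in>Pow A. E S * c S)"
    by (subst sum.swap) (simp add: c_def sum_distrib_left)
  also have "\<dots> = E {} * c {} + (\<Sum>S\<in>Pow A - {{}}. E S * c S)"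
    using A by (subst sum.remove[of _ "{}"]) auto
  also have "E {} * c {} = int p" by (simp add: E_def c_def)
  finally have F_eq: "real_of_int (\<Sum>y\<in>?Y. F y)
      = real p + (\<Sum>S\<in>Pow A - {{}}. real_of_int (E S * c S))" by simp
  have "\<bar>\<Sum>S\<in>Pow A - {{}}. real_of_int (E S * c S)\<bar> \<le> (\<Sum>S\<in>Pow A - {{}}. \<bar>real_of_int (E S * c S)\<bar>)"
    by (rule sum_abs)
  also have "\<dots> \<le> (\<Sum>S\<in>Pow A - {{}}. real (card S) * (16 / 5 * w + 1))"
  proof (rule sum_mono)
    fix S assume S: "S \<in> Pow A - {{}}"
    have "\<bar>E S\<bar> = 1"
      unfolding E_def abs_prod using S \<epsilon> by (intro prod.neutral) fastforce
    then have "\<bar>real_of_int (E S)\<bar> = 1" by (metis of_int_1 of_int_abs)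
    then have "\<bar>real_of_int (E S * c S)\<bar> = \<bar>real_of_int (c S)\<bar>" by (simp add: abs_mult)
    also have "\<dots> \<le> real (card S) * (16 / 5 * w + 1)"
      unfolding c_def w_def
      by (rule abs_sum_prod_Legendre_le) (use S A finite_subset b in \<open>auto simp: subset_iff\<close>)
    finally show "\<bar>real_of_int (E S * c S)\<bar> \<le> real (card S) * (16 / 5 * w + 1)" .
  qed
  also have "\<dots> = real (\<Sum>S\<in>Pow A. card S) * (16 / 5 * w + 1)"
    using A by (simp add: sum_distrib_right sum.remove[of "Pow A" "{}"])
  also have "real (\<Sum>S\<in>Pow A. card S) = real k * 2 ^ k / 2"
    using arg_cong[OF sum_card_Pow[OF A], of real] by (simp add: k_def)
  finally have "real p - real k * 2 ^ k / 2 * (16 / 5 * w + 1) \<le> real_of_int (\<Sum>y\<in>?Y. F y)"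
    unfolding F_eq by linarith
  with upper have "real p - real k * 2 ^ k / 2 * (16 / 5 * w + 1) \<le> 2 ^ k * (real (card G) + real k)"
    by linarith
  then have "real p / 2 ^ k - real k * (8 / 5 * w + 3 / 2) \<le> real (card G)"
    by (simp add: field_simps)
  then show ?thesis by (simp add: G_def w_def k_def)
qed

end

section \<open>Counting admissible class vectors\<close>

definition sign_solutions :: "nat \<Rightarrow> ('i set \<Rightarrow> int) \<Rightarrow> ('i set \<Rightarrow> int) \<Rightarrow> 'i set \<Rightarrow> ('i \<Rightarrow> int) set" where
  "sign_solutions p c \<epsilon> U = {l \<in> U \<rightarrow>\<^sub>E {0..<int p}.
     \<forall>\<tau>. \<tau> \<subseteq> U \<longrightarrow> \<tau> \<noteq> {} \<longrightarrow> Legendre (c \<tau> + sum l \<tau>) (int p) = \<epsilon> \<tau>}"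

lemma finite_sign_solutions: "finite U \<Longrightarrow> finite (sign_solutions p c \<epsilon> U)"
  unfolding sign_solutions_def
  by (rule finite_subset[of _ "U \<rightarrow>\<^sub>E {0..<int p}"]) (auto intro!: finite_PiE)

text \<open>Some coordinate \<open>u\<close> occurs in exactly one of the two sums, so the other
  coordinates determine it modulo \<open>p\<close>.\<close>

lemma card_subset_sum_coincidences_le:
  fixes U \<sigma> \<tau> :: "'i set" and a :: int
  assumes U: "finite U" "\<sigma> \<subseteq> U" "\<tau> \<subseteq> U" "\<sigma> \<noteq> \<tau>"
  shows "p * card {l \<in> U \<rightarrow>\<^sub>E {0..<int p}. int p dvd (a + sum l \<sigma> - sum l \<tau>)} \<le> p ^ card U"
proof -
  let ?B = "{l \<in> U \<rightarrow>\<^sub>E {0..<int p}. int p dvd (a + sum l \<sigma> - sum l \<tau>)}"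
  obtain u where u: "u \<in> U" "u \<in> \<sigma> \<longleftrightarrow> u \<notin> \<tau>" using U by auto
  have inj: "inj_on (\<lambda>l. restrict l (U - {u})) ?B"
  proof (rule inj_onI)
    fix l l' assume l: "l \<in> ?B" and l': "l' \<in> ?B"
      and eq: "restrict l (U - {u}) = restrict l' (U - {u})"
    have off: "l v = l' v" if "v \<in> U" "v \<noteq> u" for v
      using fun_cong[OF eq, of v] that by auto
    have sum_diff: "sum l S - sum l' S = (if u \<in> S then l u - l' u else 0)" if "S \<subseteq> U" for S
    proof -
      have "sum l S - sum l' S = (\<Sum>v\<in>S. if v = u then l u - l' u else 0)"
        unfolding sum_subtractf[symmetric] using off that by (intro sum.cong refl) auto
      then show ?thesis using finite_subset[OF that U(1)] by simp
    qed
    have "int p dvd (a + sum l \<sigma> - sum l \<tau>) - (a + sum l' \<sigma> - sum l' \<tau>)"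
      by (rule dvd_diff) (use l l' in auto)
    also have "\<dots> = (sum l \<sigma> - sum l' \<sigma>) - (sum l \<tau> - sum l' \<tau>)" by simp
    finally have "int p dvd l u - l' u"
      unfolding sum_diff[OF U(2)] sum_diff[OF U(3)] using u(2)
      by (auto split: if_splits simp: dvd_diff_commute)
    moreover have "l u \<in> {0..<int p}" "l' u \<in> {0..<int p}" using l l' u(1) by auto
    ultimately have "l u = l' u"
      by (metis atLeastLessThan_iff mod_eq_dvd_iff mod_pos_pos_trivial)
    then show "l = l'" using l l' off by (intro PiE_ext[of l U "\<lambda>_. {0..<int p}"]) auto
  qed
  have "card ?B \<le> card ((U - {u}) \<rightarrow>\<^sub>E {0..<int p})"
    by (rule card_inj_on_le[OF inj]) (use U in \<open>auto intro!: finite_PiE\<close>)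
  also have "\<dots> = p ^ (card U - 1)" using U(1) u(1) by (simp add: card_PiE)
  finally have "p * card ?B \<le> p * p ^ (card U - 1)" by (rule mult_left_mono) simp
  also have "\<dots> = p ^ card U" using U(1) u(1) by (metis card_gt_0_iff empty_iff power_minus_mult mult.commute)
  finally show ?thesis .
qed

text \<open>The conditions on the new coordinate \<open>y\<close> come from the \<open>k\<close>
  subsets containing \<open>x\<close> and concern the factors \<open>y + b l \<sigma>\<close>. The
  pattern count needs these shifts distinct modulo \<open>p\<close>; \<open>Bad\<close> collects the
  \<open>l\<close> for which two of them collide, and each pair of subsets accounts for at most a
  fraction \<open>1 / p\<close> of all vectors.\<close>

lemma card_sign_solutions_insert:
  fixes U :: "'i set" and p :: nat
  assumes p: "prime p" "p \<ge> 256"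
    and U: "finite U" "x \<notin> U" and \<epsilon>: "\<And>\<tau>. \<epsilon> \<tau> \<in> {-1, 1}"
    and k: "k = 2 ^ card U"
    and \<phi>: "\<phi> = real p / 2 ^ k - real k * (8 / 5 * sqrt (real p) + 3 / 2)" "\<phi> \<ge> 0"
  shows "(real (card (sign_solutions p c \<epsilon> U)) - real k ^ 2 * real p ^ card U / real p) * \<phi>
    \<le> real (card (sign_solutions p c \<epsilon> (insert x U)))"
proof -
  let ?S = "sign_solutions p c \<epsilon> U"
  define b where "b l \<sigma> = c (insert x \<sigma>) + sum l \<sigma>" for l \<sigma>
  define Bad where "Bad = {l \<in> ?S. \<exists>\<sigma>\<in>Pow U. \<exists>\<tau>\<in>Pow U. \<sigma> \<noteq> \<tau> \<and> int p dvd (b l \<sigma> - b l \<tau>)}"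
  define Y where "Y l = {y \<in> {0..<int p}. \<forall>\<sigma>\<in>Pow U. Legendre (y + b l \<sigma>) (int p) = \<epsilon> (insert x \<sigma>)}" for l
  have finS: "finite ?S" using U by (simp add: finite_sign_solutions)
  have finY: "finite (Y l)" for l
    unfolding Y_def by (rule finite_subset[OF _ finite_atLeastLessThan_int]) auto
  have Y: "\<phi> \<le> real (card (Y l))" if "l \<in> ?S - Bad" for l
  proof -
    have "\<not> int p dvd (b l \<sigma> - b l \<tau>)" if "\<sigma> \<in> Pow U" "\<tau> \<in> Pow U" "\<sigma> \<noteq> \<tau>" for \<sigma> \<tau>
      using that \<open>l \<in> ?S - Bad\<close> unfolding Bad_def by blast
    then show ?thesis
      using Legendre_pattern_count[OF p, where A = "Pow U" and b = "b l" and \<epsilon> = "\<lambda>\<sigma>. \<epsilon> (insert x \<sigma>)"] \<epsilon> U(1)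
      by (simp add: Y_def \<phi> k card_Pow)
  qed
  define D where "D \<sigma> \<tau> = {l \<in> U \<rightarrow>\<^sub>E {0..<int p}.
      int p dvd ((c (insert x \<sigma>) - c (insert x \<tau>)) + sum l \<sigma> - sum l \<tau>)}" for \<sigma> \<tau>
  have "Bad \<subseteq> (\<Union>(\<sigma>, \<tau>)\<in>{st \<in> Pow U \<times> Pow U. fst st \<noteq> snd st}. D \<sigma> \<tau>)"
  proof
    fix l assume "l \<in> Bad"
    then obtain \<sigma> \<tau> where *: "l \<in> ?S" "\<sigma> \<in> Pow U" "\<tau> \<in> Pow U" "\<sigma> \<noteq> \<tau>" "int p dvd (b l \<sigma> - b l \<tau>)"
      unfolding Bad_def by blast
    have "b l \<sigma> - b l \<tau> = (c (insert x \<sigma>) - c (insert x \<tau>)) + sum l \<sigma> - sum l \<tau>"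
      by (simp add: b_def)
    with * have "l \<in> D \<sigma> \<tau>" by (simp add: D_def sign_solutions_def)
    with * show "l \<in> (\<Union>(\<sigma>, \<tau>)\<in>{st \<in> Pow U \<times> Pow U. fst st \<noteq> snd st}. D \<sigma> \<tau>)"
      by (intro UN_I[of "(\<sigma>, \<tau>)"]) auto
  qed
  then have "card Bad \<le> card (\<Union>(\<sigma>, \<tau>)\<in>{st \<in> Pow U \<times> Pow U. fst st \<noteq> snd st}. D \<sigma> \<tau>)"
    using U(1) by (intro card_mono) (auto simp: D_def intro!: finite_PiE)
  also have "\<dots> \<le> (\<Sum>(\<sigma>, \<tau>)\<in>{st \<in> Pow U \<times> Pow U. fst st \<noteq> snd st}. card (D \<sigma> \<tau>))"
    using card_UN_le[of "{st \<in> Pow U \<times> Pow U. fst st \<noteq> snd st}" "\<lambda>(\<sigma>, \<tau>). D \<sigma> \<tau>"] U(1)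
    by (simp add: case_prod_beta)
  finally have "p * card Bad \<le> p * (\<Sum>(\<sigma>, \<tau>)\<in>{st \<in> Pow U \<times> Pow U. fst st \<noteq> snd st}. card (D \<sigma> \<tau>))"
    by (rule mult_left_mono) simp
  also have "\<dots> \<le> (\<Sum>(\<sigma>, \<tau>)\<in>{st \<in> Pow U \<times> Pow U. fst st \<noteq> snd st}. p ^ card U)"
    unfolding sum_distrib_left
    by (rule sum_mono) (use U(1) in \<open>auto simp: D_def intro!: card_subset_sum_coincidences_le\<close>)
  also have "\<dots> \<le> (\<Sum>st\<in>Pow U \<times> Pow U. p ^ card U)"
    unfolding case_prod_beta using U(1) by (intro sum_mono2) auto
  also have "\<dots> = k ^ 2 * p ^ card U"
    using U(1) by (simp add: card_cartesian_product card_Pow k power2_eq_square)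
  finally have "real (p * card Bad) \<le> real (k ^ 2 * p ^ card U)" by (simp only: of_nat_le_iff)
  then have bad: "real (card Bad) \<le> real k ^ 2 * real p ^ card U / real p"
    using p by (simp add: pos_le_divide_eq mult.commute)
  have "real (card ?S) - real (card Bad) \<le> real (card (?S - Bad))"
    using card_Un_le[of "?S - Bad" Bad] finS by (simp add: Bad_def card_Diff_subset)
  then have "(real (card ?S) - real k ^ 2 * real p ^ card U / real p) * \<phi> \<le> real (card (?S - Bad)) * \<phi>"
    using bad \<phi>(2) by (intro mult_right_mono) auto
  also have "\<dots> \<le> (\<Sum>l\<in>?S - Bad. real (card (Y l)))"
    using sum_mono[of "?S - Bad" "\<lambda>_. \<phi>" "\<lambda>l. real (card (Y l))"] Y by simp
  also have "\<dots> = real (card (Sigma (?S - Bad) Y))"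
    using finS finY by simp
  also have "card (Sigma (?S - Bad) Y) \<le> card (sign_solutions p c \<epsilon> (insert x U))"
  proof (rule card_inj_on_le)
    show "inj_on (\<lambda>(l, y). l(x := y)) (Sigma (?S - Bad) Y)"
    proof (rule inj_onI, clarify)
      fix l y l' y' assume l: "l \<in> ?S" "l' \<in> ?S" and eq: "l(x := y) = l'(x := y')"
      have "l v = l' v" if "v \<in> U" for v using fun_cong[OF eq, of v] that U(2) by (auto split: if_splits)
      then have "l = l'" using l by (intro PiE_ext[of l U "\<lambda>_. {0..<int p}"]) (auto simp: sign_solutions_def)
      then show "l = l' \<and> y = y'" using fun_cong[OF eq, of x] by simp
    qed
    show "(\<lambda>(l, y). l(x := y)) ` Sigma (?S - Bad) Y \<subseteq> sign_solutions p c \<epsilon> (insert x U)"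
    proof clarify
      fix l y assume l: "l \<in> ?S" and y: "y \<in> Y l"
      have "Legendre (c \<tau> + sum (l(x := y)) \<tau>) (int p) = \<epsilon> \<tau>" if \<tau>: "\<tau> \<subseteq> insert x U" "\<tau> \<noteq> {}" for \<tau>
      proof (cases "x \<in> \<tau>")
        case False
        then have "sum (l(x := y)) \<tau> = sum l \<tau>" by (intro sum.cong) auto
        moreover have "\<tau> \<subseteq> U" using False \<tau> by auto
        ultimately show ?thesis using l \<tau> by (simp add: sign_solutions_def)
      next
        case True
        define \<sigma> where "\<sigma> = \<tau> - {x}"
        have \<sigma>: "\<sigma> \<in> Pow U" "\<tau> = insert x \<sigma>" "x \<notin> \<sigma>" "finite \<sigma>"
          using True \<tau> U by (auto simp: \<sigma>_def intro: finite_subset)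
        have "sum (l(x := y)) \<sigma> = sum l \<sigma>" using \<sigma>(3) by (intro sum.cong) auto
        then have eq: "c \<tau> + sum (l(x := y)) \<tau> = y + b l \<sigma>" using \<sigma> by (simp add: b_def)
        show ?thesis unfolding eq using y \<sigma>(1,2) by (simp add: Y_def)
      qed
      moreover have "l \<in> U \<rightarrow>\<^sub>E {0..<int p}" "y \<in> {0..<int p}"
        using l y by (simp_all add: sign_solutions_def Y_def)
      then have "l(x := y) \<in> insert x U \<rightarrow>\<^sub>E {0..<int p}" by (rule PiE_fun_upd[rotated])
      ultimately show "l(x := y) \<in> sign_solutions p c \<epsilon> (insert x U)"
        unfolding sign_solutions_def by blast
    qed
  qed (use U in \<open>simp add: finite_sign_solutions\<close>)
  finally show ?thesis by simp
qed

text \<open>\<open>a\<close> measures how far \<open>sqrt p\<close> exceeds the critical size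
  \<open>k 2^k\<close>, and \<open>17 / 10\<close> absorbs the \<open>3 / 2\<close> into
  \<open>8 / 5 sqrt p\<close>. The lower bound on \<open>N\<close>, supplied by the previous
  coordinates, keeps the discarded vectors below \<open>N / 16\<close>.\<close>

lemma sign_step_numeric:
  fixes k :: nat and P p N a :: real
  assumes k: "k \<ge> 1" and P: "P \<ge> 0" and a: "a \<ge> 2"
    and root: "sqrt p \<ge> a * (real k * 2 ^ k)" "sqrt p \<ge> 16"
    and N: "2 * P \<le> N * (real k * 2 ^ k)"
    and \<phi>: "\<phi> = p / 2 ^ k - real k * (8 / 5 * sqrt p + 3 / 2)"
  shows "(1 - 17 / (10 * a)) * (p / 2 ^ k) \<le> \<phi>"
    and "15 / 16 * N * ((1 - 17 / (10 * a)) * (p / 2 ^ k)) \<le> (N - real k ^ 2 * P / p) * \<phi>"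
proof -
  define R where "R = sqrt p"
  define K where "K = real k * 2 ^ k"
  have K: "K \<ge> 2"
  proof -
    have "(2::real) ^ 1 \<le> 2 ^ k" using k by (intro power_increasing) auto
    then show ?thesis using k mult_mono[of 1 "real k" 2 "2 ^ k"] by (simp add: K_def)
  qed
  have R: "R \<ge> a * K" "R \<ge> 16" using root by (simp_all add: R_def K_def)
  have "p > 0" using root(2) real_sqrt_gt_0_iff[of p] by linarith
  then have p: "p = R * R" by (simp add: R_def)
  have "real k * (8 / 5 * R + 3 / 2) \<le> real k * (17 / 10 * R)"
    using R by (intro mult_left_mono) auto
  also have "\<dots> \<le> 17 / (10 * a) * (p / 2 ^ k)"
  proof -
    have "a * K * R \<le> p" unfolding p using R by (intro mult_right_mono) auto
    then show ?thesis using a by (simp add: K_def field_simps)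
  qed
  finally show \<phi>_ge: "(1 - 17 / (10 * a)) * (p / 2 ^ k) \<le> \<phi>"
    by (simp add: \<phi> R_def algebra_simps)
  have "0 \<le> N * K" using N P by (simp add: K_def)
  then have N0: "N \<ge> 0" using K by (simp add: zero_le_mult_iff)
  have pK: "4 * (K * K) \<le> p"
  proof -
    have "2 * K \<le> a * K" using a K by (intro mult_right_mono) auto
    then have "2 * K \<le> R" using R by linarith
    then have "(2 * K) * (2 * K) \<le> R * R" using K by (intro mult_mono) auto
    then show ?thesis by (simp add: p)
  qed
  have p0: "p > 0" using R by (simp add: p)
  have "2 * real k \<le> 2 ^ k"
  proof -
    have "2 * m \<le> 2 ^ m" if "m \<ge> 1" for m :: nat using that
      by (induction m rule: dec_induct) auto
    from this[OF k] show ?thesis by (metis of_nat_le_iff of_nat_mult of_nat_numeral of_nat_power)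
  qed
  then have "16 * real k ^ 2 \<le> 8 * K" using k by (simp add: K_def power2_eq_square)
  then have "16 * real k ^ 2 * P \<le> 8 * K * P" using P by (rule mult_right_mono)
  also have "\<dots> \<le> 4 * K * (N * K)" using mult_left_mono[OF N, of "4 * K"] K by (simp add: K_def)
  also have "\<dots> \<le> N * p" using mult_left_mono[OF pK N0] by (simp add: mult_ac)
  finally have "real k ^ 2 * P / p \<le> N / 16" using p0 by (simp add: field_simps)
  then have N_ge: "15 / 16 * N \<le> N - real k ^ 2 * P / p" by simp
  have "0 \<le> (1 - 17 / (10 * a)) * (p / 2 ^ k)" using a p0 by simp
  then show "15 / 16 * N * ((1 - 17 / (10 * a)) * (p / 2 ^ k)) \<le> (N - real k ^ 2 * P / p) * \<phi>"
    by (intro mult_mono[OF N_ge \<phi>_ge]) (use N_ge N0 in linarith)+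
qed

context
  fixes p r :: nat and c \<epsilon> :: "'i set \<Rightarrow> int"
  assumes p: "prime p" and r: "r \<ge> 2" and big: "p > 2 ^ (2 ^ r + 2 * r)"
    and \<epsilon>: "\<And>\<tau>. \<epsilon> \<tau> \<in> {-1, 1}"
begin

lemma sqrt_p_gt: "sqrt (real p) > 2 ^ (2 ^ (r - 1) + r)"
proof -
  have "2 ^ r + 2 * r = 2 * (2 ^ (r - 1) + r)" using r by (cases r) auto
  then have "(2 ^ (2 ^ (r - 1) + r))\<^sup>2 < real p"
    using big by (metis of_nat_less_iff of_nat_numeral of_nat_power power_mult mult.commute)
  then show ?thesis by (rule real_less_rsqrt)
qed

lemma sqrt_p_ge: "sqrt (real p) \<ge> 16"
proof -
  have "(2::nat) ^ 1 \<le> 2 ^ (r - 1)" using r by (intro power_increasing) auto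
  then have "(2::real) ^ 4 \<le> 2 ^ (2 ^ (r - 1) + r)" using r by (intro power_increasing) auto
  then show ?thesis using sqrt_p_gt by simp
qed

lemma p_ge_256: "p \<ge> 256"
proof -
  have "16\<^sup>2 \<le> (sqrt (real p))\<^sup>2" using sqrt_p_ge by (intro power_mono) auto
  then show ?thesis by simp
qed

text \<open>The exponent is the sum of \<open>2^i + 1\<close> over \<open>i < card U\<close>: a
  coordinate costs \<open>2^(2^i)\<close> for the pattern and a factor 2 for the errors. As
  \<open>card U < r\<close>, \<open>sqrt p\<close> exceeds the critical size 8 times, and
  \<open>15 / 16 * (1 - 17 / 80) > 1 / 2\<close>.\<close>

lemma power_le_card_sign_solutions:
  assumes "finite U" "card U < r"
  shows "p ^ card U \<le> card (sign_solutions p c \<epsilon> U) * 2 ^ (2 ^ card U - 1 + card U)"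
  using assms
proof (induction U rule: finite_induct)
  case empty
  then show ?case by (simp add: sign_solutions_def)
next
  case (insert x U)
  define j k where "j = card U" and "k = (2::nat) ^ j"
  have jr: "Suc j < r" using insert by (simp add: j_def)
  let ?N = "real (card (sign_solutions p c \<epsilon> U))"
  let ?N' = "real (card (sign_solutions p c \<epsilon> (insert x U)))"
  define \<phi> where "\<phi> = real p / 2 ^ k - real k * (8 / 5 * sqrt (real p) + 3 / 2)"
  have k1: "k \<ge> 1" by (simp add: k_def)
  have "p ^ j \<le> card (sign_solutions p c \<epsilon> U) * 2 ^ (k - 1 + j)"
    using insert by (simp add: j_def k_def)
  then have "real (p ^ j) \<le> real (card (sign_solutions p c \<epsilon> U) * 2 ^ (k - 1 + j))"
    by (simp only: of_nat_le_iff)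
  moreover have pk: "2 * 2 ^ (k - 1 + j) = real k * 2 ^ k"
    using k1 by (simp add: power_add k_def flip: power_Suc)
  ultimately have N: "2 * real p ^ j \<le> ?N * (real k * 2 ^ k)"
    by (simp flip: pk)
  have root: "sqrt (real p) \<ge> 8 * (real k * 2 ^ k)"
  proof -
    have "2 * k \<le> 2 ^ (r - 1)"
      unfolding k_def power_Suc[symmetric] using jr by (intro power_increasing) auto
    then have "k + j + 3 \<le> 2 ^ (r - 1) + r" using jr k1 by linarith
    then have "(2::real) ^ (k + j + 3) \<le> 2 ^ (2 ^ (r - 1) + r)" by (intro power_increasing) auto
    then show ?thesis using sqrt_p_gt by (simp add: power_add k_def mult_ac)
  qed
  note num = sign_step_numeric[where a = 8, OF k1 _ _ root sqrt_p_ge N \<phi>_def]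
  have "\<phi> \<ge> 0" by (rule order.trans[OF _ num(1)]) auto
  then have "(?N - real k ^ 2 * real p ^ j / real p) * \<phi> \<le> ?N'"
    unfolding j_def using p p_ge_256 insert \<epsilon>
    by (intro card_sign_solutions_insert) (auto simp: \<phi>_def k_def j_def)
  with num(2) have "15 / 16 * ?N * ((1 - 17 / 80) * (real p / 2 ^ k)) \<le> ?N'" by simp
  moreover have "1 / 2 * (?N * (real p / 2 ^ k)) \<le> 15 / 16 * ?N * ((1 - 17 / 80) * (real p / 2 ^ k))"
    by (simp add: field_simps)
  ultimately have "?N * real p / (2 * 2 ^ k) \<le> ?N'" by simp
  then have "?N * real p \<le> ?N' * (2 * 2 ^ k)" by (simp add: pos_divide_le_eq)
  then have "real (card (sign_solutions p c \<epsilon> U) * p)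
      \<le> real (card (sign_solutions p c \<epsilon> (insert x U)) * 2 ^ Suc k)" by simp
  then have step: "card (sign_solutions p c \<epsilon> U) * p
      \<le> card (sign_solutions p c \<epsilon> (insert x U)) * 2 ^ Suc k" by (simp only: of_nat_le_iff)
  have "p ^ Suc j \<le> card (sign_solutions p c \<epsilon> U) * p * 2 ^ (k - 1 + j)"
    using mult_right_mono[OF \<open>p ^ j \<le> _\<close>, of p] by (simp add: mult_ac)
  also have "\<dots> \<le> card (sign_solutions p c \<epsilon> (insert x U)) * 2 ^ Suc k * 2 ^ (k - 1 + j)"
    by (rule mult_right_mono[OF step]) simp
  also have "\<dots> = card (sign_solutions p c \<epsilon> (insert x U)) * 2 ^ (2 ^ Suc j - 1 + Suc j)"
  proof -
    have "Suc k + (k - 1 + j) = 2 ^ Suc j - 1 + Suc j" using k1 by (simp add: k_def)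
    then show ?thesis by (metis mult.assoc power_add)
  qed
  finally show ?case using insert by (simp add: j_def)
qed

text \<open>When \<open>card U = r\<close>, the last coordinate has only the factor
  \<open>a = 2\<close> to spare, and \<open>15 / 16 * (1 - 17 / 20) > 1 / 8\<close> costs 8 instead
  of 2. Outside the induction this loss occurs once.\<close>

lemma power_le_card_sign_solutions':
  assumes "finite U" "card U \<le> r" "U \<noteq> {}"
  shows "p ^ card U \<le> card (sign_solutions p c \<epsilon> U) * 2 ^ (2 ^ card U + card U + 1)"
proof -
  from assms obtain x V where V: "U = insert x V" "x \<notin> V" "finite V"
    by (metis Set.set_insert ex_in_conv finite_insert)
  define j k where "j = card V" and "k = (2::nat) ^ j"
  have jr: "j < r" using V assms by (simp add: j_def)
  let ?N = "real (card (sign_solutions p c \<epsilon> V))"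
  let ?N' = "real (card (sign_solutions p c \<epsilon> (insert x V)))"
  define \<phi> where "\<phi> = real p / 2 ^ k - real k * (8 / 5 * sqrt (real p) + 3 / 2)"
  have k1: "k \<ge> 1" by (simp add: k_def)
  have IH: "p ^ j \<le> card (sign_solutions p c \<epsilon> V) * 2 ^ (k - 1 + j)"
    using power_le_card_sign_solutions[of V] V jr by (simp add: j_def k_def)
  then have "real (p ^ j) \<le> real (card (sign_solutions p c \<epsilon> V) * 2 ^ (k - 1 + j))"
    by (simp only: of_nat_le_iff)
  moreover have pk: "2 * 2 ^ (k - 1 + j) = real k * 2 ^ k"
    using k1 by (simp add: power_add k_def flip: power_Suc)
  ultimately have N: "2 * real p ^ j \<le> ?N * (real k * 2 ^ k)"
    by (simp flip: pk)
  have root: "sqrt (real p) \<ge> 2 * (real k * 2 ^ k)"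
  proof -
    have "k \<le> 2 ^ (r - 1)"
      unfolding k_def using jr by (intro power_increasing) auto
    then have "k + j + 1 \<le> 2 ^ (r - 1) + r" using jr k1 by linarith
    then have "(2::real) ^ (k + j + 1) \<le> 2 ^ (2 ^ (r - 1) + r)" by (intro power_increasing) auto
    then show ?thesis using sqrt_p_gt by (simp add: power_add k_def mult_ac)
  qed
  note num = sign_step_numeric[where a = 2, OF k1 _ _ root sqrt_p_ge N \<phi>_def]
  have "\<phi> \<ge> 0" by (rule order.trans[OF _ num(1)]) auto
  then have "(?N - real k ^ 2 * real p ^ j / real p) * \<phi> \<le> ?N'"
    unfolding j_def using p p_ge_256 V \<epsilon>
    by (intro card_sign_solutions_insert) (auto simp: \<phi>_def k_def j_def)
  with num(2) have "15 / 16 * ?N * ((1 - 17 / 20) * (real p / 2 ^ k)) \<le> ?N'" by simp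
  moreover have "1 / 8 * (?N * (real p / 2 ^ k)) \<le> 15 / 16 * ?N * ((1 - 17 / 20) * (real p / 2 ^ k))"
    by (simp add: field_simps)
  ultimately have "?N * real p / (8 * 2 ^ k) \<le> ?N'" by simp
  then have "?N * real p \<le> ?N' * (8 * 2 ^ k)" by (simp add: pos_divide_le_eq)
  then have "real (card (sign_solutions p c \<epsilon> V) * p)
      \<le> real (card (sign_solutions p c \<epsilon> (insert x V)) * 2 ^ (k + 3))" by (simp add: power_add)
  then have step: "card (sign_solutions p c \<epsilon> V) * p
      \<le> card (sign_solutions p c \<epsilon> (insert x V)) * 2 ^ (k + 3)" by (simp only: of_nat_le_iff)
  have "p ^ Suc j \<le> card (sign_solutions p c \<epsilon> V) * p * 2 ^ (k - 1 + j)"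
    using mult_right_mono[OF IH, of p] by (simp add: mult_ac)
  also have "\<dots> \<le> card (sign_solutions p c \<epsilon> (insert x V)) * 2 ^ (k + 3) * 2 ^ (k - 1 + j)"
    by (rule mult_right_mono[OF step]) simp
  also have "\<dots> = card (sign_solutions p c \<epsilon> (insert x V)) * 2 ^ (2 ^ Suc j + Suc j + 1)"
  proof -
    have "k + 3 + (k - 1 + j) = 2 ^ Suc j + Suc j + 1" using k1 by (simp add: k_def)
    then show ?thesis by (metis mult.assoc power_add)
  qed
  finally show ?thesis using V by (simp add: j_def)
qed

end

section \<open>Discrete logarithms modulo p\<close>

lemma finite_field_power_card_minus_1:
  fixes x :: "'a::{field,finite}"
  assumes "x \<noteq> 0"
  shows "x ^ (CARD('a) - 1) = 1"
proof -
  have "(\<Prod>y\<in>UNIV - {0::'a}. x * y) = (\<Prod>y\<in>UNIV - {0}. y)"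
    by (rule prod.reindex_bij_witness[of _ "\<lambda>y. y / x" "\<lambda>y. x * y"]) (use assms in auto)
  then have "x ^ (CARD('a) - 1) * \<Prod>(UNIV - {0}) = \<Prod>(UNIV - {0::'a})"
    by (simp add: prod.distrib card_Diff_singleton)
  moreover have "\<Prod>(UNIV - {0::'a}) \<noteq> 0" by simp
  ultimately show ?thesis by simp
qed

locale paley_field =
  fixes n p :: nat and g :: "'a::{field,finite}"
  assumes n: "n = CARD('a)" and prime_p: "prime p" and odd_p: "odd p" and p_dvd: "p dvd n - 1"
    and primitive: "primitive_element g"
begin

text \<open>The order of the subgroup of \<open>p\<close>-th powers; on nonzero \<open>x\<close>,
  the map \<open>x^h\<close> is a character of order \<open>p\<close> with values in the field
  itself.\<close>

definition h :: nat where "h = (n - 1) div p"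

lemma n_gt_1: "n > 1"
proof -
  have "{0, 1::'a} \<subseteq> UNIV" by simp
  then have "card {0, 1::'a} \<le> n" unfolding n by (rule card_mono[rotated]) simp
  then show ?thesis by simp
qed

lemma power_n_minus_1: "x \<noteq> 0 \<Longrightarrow> x ^ (n - 1) = (1::'a)"
  unfolding n by (rule finite_field_power_card_minus_1)

lemma p_gt_1: "p > 1"
  using prime_p prime_gt_1_nat by blast

lemma h_eq: "p * h = n - 1"
  unfolding h_def using p_dvd by simp

lemma g_nonzero: "g \<noteq> 0"
proof
  assume "g = 0"
  have "g powi 1 \<in> range (\<lambda>k::int. g powi k)" by blast
  then show False using primitive \<open>g = 0\<close> by (auto simp: primitive_element_def)
qed

lemma powi_eq: "g powi k = g ^ nat (k mod int (n - 1))"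
proof -
  have "g powi k = g powi (k mod int (n - 1) + int (n - 1) * (k div int (n - 1)))"
    by simp
  also have "\<dots> = g powi (k mod int (n - 1)) * (g powi int (n - 1)) powi (k div int (n - 1))"
    using g_nonzero by (simp only: power_int_add power_int_mult simp_thms)
  also have "g powi int (n - 1) = 1"
    using power_n_minus_1[OF g_nonzero] by (simp only: power_int_of_nat)
  also have "g powi (k mod int (n - 1)) = g ^ nat (k mod int (n - 1))"
    using n_gt_1 by (simp add: power_int_def)
  finally show ?thesis by simp
qed

lemma bij_power: "bij_betw (\<lambda>k. g ^ k) {..<n - 1} (UNIV - {0})"
proof -
  have im: "(\<lambda>k. g ^ k) ` {..<n - 1} = UNIV - {0}"
  proof
    show "UNIV - {0} \<subseteq> (\<lambda>k. g ^ k) ` {..<n - 1}"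
    proof
      fix x assume "x \<in> UNIV - {0::'a}"
      then obtain k :: int where "x = g powi k" using primitive by (auto simp: primitive_element_def)
      then have "x = g ^ nat (k mod int (n - 1))" by (simp only: powi_eq)
      moreover have "nat (k mod int (n - 1)) < n - 1" using n_gt_1 by (simp add: nat_less_iff)
      ultimately show "x \<in> (\<lambda>k. g ^ k) ` {..<n - 1}" by blast
    qed
  qed (use g_nonzero in auto)
  then have "inj_on (\<lambda>k. g ^ k) {..<n - 1}"
    by (intro eq_card_imp_inj_on) (simp_all add: card_Diff_singleton n)
  with im show ?thesis by (simp add: bij_betw_def)
qed

definition dlog :: "'a \<Rightarrow> nat" where
  "dlog = inv_into {..<n - 1} (\<lambda>k. g ^ k)"

definition cl :: "'a \<Rightarrow> int" where
  "cl x = int (dlog x) mod int p"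

lemma power_dlog: "x \<noteq> 0 \<Longrightarrow> g ^ dlog x = x"
  using bij_power unfolding dlog_def bij_betw_def by (intro f_inv_into_f[of x "\<lambda>k. g ^ k"]) auto

lemma cl_power: "cl (g ^ k) = int k mod int p"
proof -
  have "g ^ k = g ^ (k mod (n - 1))"
    using powi_eq[of "int k"] by (simp only: zmod_int[symmetric] nat_int power_int_of_nat)
  moreover have "k mod (n - 1) < n - 1" using n_gt_1 by simp
  ultimately have "dlog (g ^ k) = k mod (n - 1)"
    unfolding dlog_def using bij_power by (simp add: bij_betw_def inv_into_f_f)
  then show ?thesis using p_dvd by (simp add: cl_def mod_mod_cancel flip: zmod_int)
qed

lemma cl_range: "cl x \<in> {0..<int p}"
  using p_gt_1 by (simp add: cl_def)

lemma cl_mult: "x \<noteq> 0 \<Longrightarrow> y \<noteq> 0 \<Longrightarrow> [cl (x * y) = cl x + cl y] (mod int p)"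
proof -
  assume "x \<noteq> 0" "y \<noteq> 0"
  then have "x * y = g ^ (dlog x + dlog y)" by (simp add: power_add power_dlog)
  then show ?thesis by (simp add: cl_power cong_def) (simp add: cl_def mod_add_eq)
qed

lemma cl_1: "cl 1 = 0"
  using cl_power[of 0] by simp

lemma cl_prod: "(\<And>i. i \<in> A \<Longrightarrow> f i \<noteq> 0) \<Longrightarrow> [cl (prod f A) = (\<Sum>i\<in>A. cl (f i))] (mod int p)"
proof (induction A rule: infinite_finite_induct)
  case (insert i A)
  then have "[cl (f i * prod f A) = cl (f i) + cl (prod f A)] (mod int p)"
    by (intro cl_mult) auto
  also have "[cl (f i) + cl (prod f A) = cl (f i) + (\<Sum>i\<in>A. cl (f i))] (mod int p)"
    using insert by (intro cong_add) auto
  finally show ?case using insert by simp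
qed (auto simp: cl_1)

lemma cl_eq_iff_cong: "cl x = cl y \<longleftrightarrow> [cl x = cl y] (mod int p)"
  using cl_range[of x] cl_range[of y] by (simp add: cong_def)

text \<open>\<open>-1\<close> squares to 1 and \<open>p\<close> is odd, so \<open>-1\<close> has
  class 0. Classes of difference products are therefore independent of the ordering.\<close>

lemma cl_uminus: "x \<noteq> 0 \<Longrightarrow> cl (- x) = cl x"
proof -
  assume x: "x \<noteq> 0"
  have "[cl ((-1) * (-1)) = cl (-1) + cl (-1)] (mod int p)" by (rule cl_mult) auto
  then have "int p dvd 2 * cl (-1)" by (simp add: cl_1 cong_sym_eq[of 0] cong_0_iff)
  moreover have "coprime (int p) 2" using odd_p by simp
  ultimately have "int p dvd cl (-1)" using coprime_dvd_mult_right_iff by blast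
  then have "[cl (-1) + cl x = 0 + cl x] (mod int p)" by (intro cong_add) (auto simp: cong_0_iff)
  moreover have "[cl (-1 * x) = cl (-1) + cl x] (mod int p)" using x by (intro cl_mult) auto
  ultimately show ?thesis unfolding cl_eq_iff_cong by (auto intro: cong_trans)
qed

lemma cl_diff_sym: "cl (x - y) = cl (y - x)"
  by (metis cl_uminus minus_diff_eq neg_equal_0_iff_equal)

lemma power_h: "x \<noteq> 0 \<Longrightarrow> x ^ h = (g ^ h) ^ nat (cl x)"
proof -
  assume x: "x \<noteq> 0"
  have c: "nat (cl x) = dlog x mod p" unfolding cl_def by (simp only: zmod_int[symmetric] nat_int)
  have "x ^ h = g ^ (dlog x * h)" by (simp add: power_mult power_dlog x)
  also have "dlog x * h = (dlog x mod p + p * (dlog x div p)) * h" by simp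
  also have "\<dots> = h * nat (cl x) + (n - 1) * (dlog x div p)"
    unfolding c h_eq[symmetric] by (simp only: add_mult_distrib add_mult_distrib2 mult_ac)
  finally show ?thesis
    using power_n_minus_1[OF g_nonzero] by (simp add: power_add power_mult)
qed

lemma power_root_mod: "(g ^ h) ^ (k mod p) = (g ^ h) ^ k"
proof -
  have "(g ^ h) ^ p = 1"
    using h_eq by (metis power_n_minus_1 g_nonzero mult.commute power_mult)
  then have "(g ^ h) ^ (k mod p + p * (k div p)) = (g ^ h) ^ (k mod p)"
    by (simp only: power_add power_mult power_one mult_1_right)
  then show ?thesis by simp
qed

lemma mem_paley_set:
  assumes "x \<noteq> 0"
  shows "x \<in> paley_set p g \<longleftrightarrow> (\<exists>b. [b\<^sup>2 = cl x] (mod int p))"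
proof
  assume "x \<in> paley_set p g"
  then obtain a b where ab: "x = g powi a" "[a = b\<^sup>2] (mod int p)" by (auto simp: paley_set_def)
  have "int p dvd int (n - 1)" using p_dvd by simp
  then have "cl x = a mod int p"
    using ab(1) n_gt_1 by (simp add: powi_eq cl_power mod_mod_cancel)
  then show "\<exists>b. [b\<^sup>2 = cl x] (mod int p)" using ab(2) by (auto simp: cong_def)
next
  assume "\<exists>b. [b\<^sup>2 = cl x] (mod int p)"
  then obtain b where "[b\<^sup>2 = cl x] (mod int p)" by auto
  then have "[int (dlog x) = b\<^sup>2] (mod int p)" by (simp add: cong_def cl_def)
  moreover have "x = g powi int (dlog x)" using power_dlog[OF assms] by simp
  ultimately show "x \<in> paley_set p g" unfolding paley_set_def by blast
qed

lemma card_cl_eq_0: "card {x. x \<noteq> 0 \<and> cl x = 0} = h"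
proof -
  have "{x. x \<noteq> 0 \<and> cl x = 0} = (\<lambda>k. g ^ (p * k)) ` {..<h}"
  proof
    show "{x. x \<noteq> 0 \<and> cl x = 0} \<subseteq> (\<lambda>k. g ^ (p * k)) ` {..<h}"
    proof
      fix x assume "x \<in> {x. x \<noteq> 0 \<and> cl x = 0}"
      then have x: "x \<noteq> 0" "p dvd dlog x" by (auto simp: cl_def dvd_eq_mod_eq_0 simp flip: zmod_int)
      then obtain k where k: "dlog x = p * k" by (elim dvdE)
      have "dlog x \<in> {..<n - 1}"
        unfolding dlog_def using bij_power x(1) by (intro inv_into_into) (auto simp: bij_betw_def)
      then have "k < h" unfolding k h_eq[symmetric] using p_gt_1 by simp
      then show "x \<in> (\<lambda>k. g ^ (p * k)) ` {..<h}" using power_dlog[OF x(1)] k by auto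
    qed
  qed (use g_nonzero in \<open>auto simp: cl_power\<close>)
  moreover have "inj_on (\<lambda>k. g ^ (p * k)) {..<h}"
  proof (rule inj_onI)
    fix i j assume "i \<in> {..<h}" "j \<in> {..<h}" and eq: "g ^ (p * i) = g ^ (p * j)"
    then have "p * i < n - 1" "p * j < n - 1" unfolding h_eq[symmetric] using p_gt_1 by auto
    moreover have "inj_on (\<lambda>k. g ^ k) {..<n - 1}" using bij_power by (simp add: bij_betw_def)
    ultimately have "p * i = p * j" using eq unfolding inj_on_def by blast
    then show "i = j" using p_gt_1 by simp
  qed
  ultimately show ?thesis by (simp add: card_image)
qed

end

text \<open>Every unordered pair is counted twice, so for symmetric weights the division is exact.\<close>

definition pair_weight :: "('a \<Rightarrow> 'a \<Rightarrow> int) \<Rightarrow> 'a set \<Rightarrow> int" where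
  "pair_weight w S = (\<Sum>x\<in>S. \<Sum>y\<in>S - {x}. w x y) div 2"

lemma sum_pairs_insert:
  fixes w :: "'a \<Rightarrow> 'a \<Rightarrow> int"
  assumes "finite S" "v \<notin> S" "\<And>x y. w x y = w y x"
  shows "(\<Sum>x\<in>insert v S. \<Sum>y\<in>insert v S - {x}. w x y)
    = (\<Sum>x\<in>S. \<Sum>y\<in>S - {x}. w x y) + 2 * (\<Sum>y\<in>S. w v y)"
proof -
  have "(\<Sum>y\<in>insert v S - {x}. w x y) = w x v + (\<Sum>y\<in>S - {x}. w x y)" if "x \<in> S" for x
  proof -
    have "insert v S - {x} = insert v (S - {x})" using that assms by auto
    then show ?thesis using assms by simp
  qed
  then have "(\<Sum>x\<in>S. \<Sum>y\<in>insert v S - {x}. w x y) = (\<Sum>x\<in>S. w v x) + (\<Sum>x\<in>S. \<Sum>y\<in>S - {x}. w x y)"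
    using assms(3) by (simp add: sum.distrib)
  moreover have "insert v S - {v} = S" using assms(2) by auto
  ultimately show ?thesis using assms(1,2) by simp
qed

lemma pair_weight_insert:
  assumes "finite S" "v \<notin> S" "\<And>x y. w x y = w y x"
  shows "pair_weight w (insert v S) = pair_weight w S + (\<Sum>y\<in>S. w v y)"
  unfolding pair_weight_def sum_pairs_insert[OF assms] by simp

lemma sum_list_pairs_eq_pair_weight:
  assumes "distinct xs" "\<And>x y. w x y = w y x"
  shows "(\<Sum>j<length xs. \<Sum>i<j. w (xs ! i) (xs ! j)) = pair_weight w (set xs)"
  using assms(1)
proof (induction xs rule: rev_induct)
  case (snoc x xs)
  have "(\<Sum>i<length xs. w (xs ! i) x) = (\<Sum>y\<in>set xs. w x y)"
    using snoc.prems assms(2)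
    by (subst sum.reindex_bij_betw[OF bij_betw_nth[of xs "{..<length xs}" "set xs"], symmetric]) auto
  moreover have "(\<Sum>j<length xs. \<Sum>i<j. w ((xs @ [x]) ! i) ((xs @ [x]) ! j))
      = (\<Sum>j<length xs. \<Sum>i<j. w (xs ! i) (xs ! j))"
    by (intro sum.cong refl) (simp add: nth_append)
  ultimately show ?case
    using snoc assms(2) by (simp add: nth_append pair_weight_insert)
qed (simp add: pair_weight_def)

section \<open>Simplices and links in terms of classes\<close>

context paley_field
begin

definition pw :: "'a set \<Rightarrow> int" where
  "pw = pair_weight (\<lambda>x y. cl (x - y))"

lemma diff_prod_nonzero: "distinct xs \<Longrightarrow> diff_prod xs \<noteq> (0::'a)"
  by (auto simp: diff_prod_def distinct_conv_nth)

lemma cl_diff_prod: "distinct xs \<Longrightarrow> [cl (diff_prod xs) = pw (set xs)] (mod int p)"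
proof -
  assume d: "distinct xs"
  have nz: "(\<Prod>i<j. xs ! i - xs ! j) \<noteq> 0" if "j < length xs" for j
    using d that by (auto simp: distinct_conv_nth)
  have "[cl (diff_prod xs) = (\<Sum>j<length xs. cl (\<Prod>i<j. xs ! i - xs ! j))] (mod int p)"
    unfolding diff_prod_def by (rule cl_prod) (use nz in auto)
  also have "[(\<Sum>j<length xs. cl (\<Prod>i<j. xs ! i - xs ! j))
      = (\<Sum>j<length xs. \<Sum>i<j. cl (xs ! i - xs ! j))] (mod int p)"
    using d by (intro cong_sum cl_prod) (auto simp: distinct_conv_nth)
  also have "(\<Sum>j<length xs. \<Sum>i<j. cl (xs ! i - xs ! j)) = pw (set xs)"
    unfolding pw_def by (rule sum_list_pairs_eq_pair_weight[OF d cl_diff_sym])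
  finally show ?thesis .
qed

lemma pw_insert: "finite S \<Longrightarrow> v \<notin> S \<Longrightarrow> pw (insert v S) = pw S + (\<Sum>u\<in>S. cl (v - u))"
  unfolding pw_def by (rule pair_weight_insert) (auto intro: cl_diff_sym)

lemma diff_prod_mem_paley_set:
  "distinct xs \<Longrightarrow> diff_prod xs \<in> paley_set p g \<longleftrightarrow> (\<exists>b. [b\<^sup>2 = pw (set xs)] (mod int p))"
  unfolding mem_paley_set[OF diff_prod_nonzero] using cl_diff_prod cong_sym cong_trans by blast

text \<open>All orderings of a subset have the same class \<open>pw\<close> modulo \<open>p\<close>,
  so one listing of each subset decides.\<close>

lemma mem_complex_iff:
  "\<sigma> \<in> iterated_paley_complex p g \<longleftrightarrow>
    \<sigma> \<noteq> {} \<and> (\<forall>\<tau>\<subseteq>\<sigma>. \<tau> \<noteq> {} \<longrightarrow> (\<exists>b. [b\<^sup>2 = pw \<tau>] (mod int p)))"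
proof -
  have "(\<forall>xs. distinct xs \<longrightarrow> xs \<noteq> [] \<longrightarrow> set xs \<subseteq> \<sigma> \<longrightarrow> diff_prod xs \<in> paley_set p g)
    \<longleftrightarrow> (\<forall>\<tau>\<subseteq>\<sigma>. \<tau> \<noteq> {} \<longrightarrow> (\<exists>b. [b\<^sup>2 = pw \<tau>] (mod int p)))" (is "?A \<longleftrightarrow> ?B")
  proof
    assume A: ?A
    show ?B
    proof (intro allI impI)
      fix \<tau> assume "\<tau> \<subseteq> \<sigma>" "\<tau> \<noteq> {}"
      moreover obtain xs where "set xs = \<tau>" "distinct xs"
        using finite_distinct_list[of \<tau>] by auto
      ultimately show "\<exists>b. [b\<^sup>2 = pw \<tau>] (mod int p)"
        using A diff_prod_mem_paley_set by fastforce
    qed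
  next
    assume ?B
    then show ?A by (simp add: diff_prod_mem_paley_set)
  qed
  then show ?thesis by (simp add: iterated_paley_complex_def)
qed

lemma singleton_mem_complex: "{v} \<in> iterated_paley_complex p g"
proof -
  have "\<exists>b. [b\<^sup>2 = pw {v}] (mod int p)"
    by (rule exI[of _ 0]) (simp add: pw_def pair_weight_def)
  then show ?thesis unfolding mem_complex_iff by (auto simp: subset_singleton_iff)
qed

lemma vertex_set_complex: "vertex_set (iterated_paley_complex p g) = UNIV"
  using singleton_mem_complex by (auto simp: vertex_set_def)

lemma complex_is_complex: "abstract_simplicial_complex (iterated_paley_complex p g)"
  unfolding abstract_simplicial_complex_def by (auto simp: mem_complex_iff)

text \<open>A class 0 is a square too, but the symbols here are never 0, so -1 marks exactly the
  nonsquares. For \<open>\<sigma> \<in> A\<close> the downward closure of \<open>A\<close> makes all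
  subsets through \<open>v\<close> squares; for \<open>\<sigma> \<notin> A\<close> the set
  \<open>insert v \<sigma>\<close> itself fails.\<close>

lemma link_of_sign_solution:
  fixes A :: "'a set set"
  assumes A: "abstract_simplicial_complex A" "A \<subseteq> induced_subcomplex (iterated_paley_complex p g) U"
    and v: "v \<notin> U"
    and sol: "(\<lambda>u\<in>U. cl (v - u)) \<in> sign_solutions p pw (\<lambda>\<tau>. if \<tau> \<in> A then 1 else -1) U"
  shows "vertex_link (iterated_paley_complex p g) v
    \<inter> induced_subcomplex (iterated_paley_complex p g) U = A"
proof -
  let ?X = "iterated_paley_complex p g"
  have leg: "Legendre (pw (insert v \<tau>)) (int p) = (if \<tau> \<in> A then 1 else -1)" if "\<tau> \<subseteq> U" "\<tau> \<noteq> {}" for \<tau>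
  proof -
    have "sum (\<lambda>u\<in>U. cl (v - u)) \<tau> = (\<Sum>u\<in>\<tau>. cl (v - u))" using that by (intro sum.cong) auto
    then have "pw (insert v \<tau>) = pw \<tau> + sum (\<lambda>u\<in>U. cl (v - u)) \<tau>"
      using that v by (subst pw_insert) auto
    then show ?thesis using sol that by (simp add: sign_solutions_def)
  qed
  have square_iff: "(\<exists>b. [b\<^sup>2 = pw (insert v \<tau>)] (mod int p)) \<longleftrightarrow> \<tau> \<in> A" if "\<tau> \<subseteq> U" "\<tau> \<noteq> {}" for \<tau>
  proof -
    have "\<exists>b. [b\<^sup>2 = pw (insert v \<tau>)] (mod int p)" if "[pw (insert v \<tau>) = 0] (mod int p)"
      using that by (intro exI[of _ 0]) (simp add: cong_sym_eq)
    then have "(\<exists>b. [b\<^sup>2 = pw (insert v \<tau>)] (mod int p)) \<longleftrightarrow> Legendre (pw (insert v \<tau>)) (int p) \<noteq> -1"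
      unfolding Legendre_def QuadRes_def by auto
    then show ?thesis by (simp add: leg[OF that])
  qed
  have "insert v \<sigma> \<in> ?X \<longleftrightarrow> \<sigma> \<in> A" if \<sigma>: "\<sigma> \<in> ?X" "\<sigma> \<subseteq> U" for \<sigma>
  proof
    assume "insert v \<sigma> \<in> ?X"
    then have "\<exists>b. [b\<^sup>2 = pw (insert v \<sigma>)] (mod int p)" unfolding mem_complex_iff by blast
    moreover have "\<sigma> \<noteq> {}" using \<sigma> by (simp add: mem_complex_iff)
    ultimately show "\<sigma> \<in> A" using square_iff \<sigma> by blast
  next
    assume \<sigma>A: "\<sigma> \<in> A"
    show "insert v \<sigma> \<in> ?X"
      unfolding mem_complex_iff
    proof (intro conjI allI impI)
      fix \<tau> assume \<tau>: "\<tau> \<subseteq> insert v \<sigma>" "\<tau> \<noteq> {}"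
      show "\<exists>b. [b\<^sup>2 = pw \<tau>] (mod int p)"
      proof (cases "v \<in> \<tau>")
        case False
        then have "\<tau> \<subseteq> \<sigma>" using \<tau> by auto
        then show ?thesis using \<sigma>(1) \<tau>(2) by (simp add: mem_complex_iff)
      next
        case True
        define \<tau>' where "\<tau>' = \<tau> - {v}"
        have \<tau>': "\<tau> = insert v \<tau>'" "\<tau>' \<subseteq> \<sigma>" using True \<tau> by (auto simp: \<tau>'_def)
        show ?thesis
        proof (cases "\<tau>' = {}")
          case True
          then show ?thesis using \<tau>' by (auto simp: pw_def pair_weight_def intro!: exI[of _ 0])
        next
          case False
          then have "\<tau>' \<in> A" using A(1) \<sigma>A \<tau>'(2) unfolding abstract_simplicial_complex_def by blast
          then show ?thesis unfolding \<tau>'(1) using square_iff[of \<tau>'] \<tau>'(2) \<sigma>(2) False by blast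
        qed
      qed
    qed simp
  qed
  then show ?thesis using A(2) v by (auto simp: vertex_link_def induced_subcomplex_def)
qed

end

section \<open>Distribution of class vectors\<close>

lemma card_coincident_pairs:
  assumes "finite V" "finite \<Lambda>" "f ` V \<subseteq> \<Lambda>"
  shows "card {(v, v'). v \<in> V \<and> v' \<in> V \<and> f v = f v'} = (\<Sum>l\<in>\<Lambda>. (card {v \<in> V. f v = l})\<^sup>2)"
proof -
  have "{(v, v'). v \<in> V \<and> v' \<in> V \<and> f v = f v'} = (\<Union>l\<in>\<Lambda>. {v \<in> V. f v = l} \<times> {v \<in> V. f v = l})"
    using assms(3) by auto
  then show ?thesis
    using assms by (simp only:) (subst card_UN_disjoint, auto simp: card_cartesian_product power2_eq_square)
qed

lemma card_eq_sum_fibres: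
  assumes "finite V" "finite \<Lambda>" "f ` V \<subseteq> \<Lambda>"
  shows "card V = (\<Sum>l\<in>\<Lambda>. card {v \<in> V. f v = l})"
proof -
  have "V = (\<Union>l\<in>\<Lambda>. {v \<in> V. f v = l})" using assms(3) by auto
  then have "card V = card (\<Union>l\<in>\<Lambda>. {v \<in> V. f v = l})" by simp
  also have "\<dots> = (\<Sum>l\<in>\<Lambda>. card {v \<in> V. f v = l})"
    using assms by (intro card_UN_disjoint) auto
  finally show ?thesis .
qed

text \<open>Cauchy-Schwarz for the sizes of the fibres of \<open>f\<close>.\<close>

lemma card_sq_le_coincident_pairs:
  assumes "finite V" "finite \<Lambda>" "f ` V \<subseteq> \<Lambda>"
  shows "(real (card V))\<^sup>2 \<le> real (card \<Lambda>) * real (card {(v, v'). v \<in> V \<and> v' \<in> V \<and> f v = f v'})"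
  unfolding card_coincident_pairs[OF assms] card_eq_sum_fibres[OF assms]
  using sum_squared_le_sum_of_squares[of "\<lambda>l. real (card {v \<in> V. f v = l})" \<Lambda>]
  by (simp add: mult.commute)

text \<open>Only upper bounds for the \<open>M c\<close> are available. The gaps \<open>y c\<close>
  below the bound are nonnegative with sum \<open>p E\<close>, so their squares sum to at most
  \<open>(p E)^2\<close>; a two-sided bound by \<open>E\<close> would give
  \<open>p E^2\<close>.\<close>

lemma sum_squares_le_of_upper_bound:
  fixes M :: "'c \<Rightarrow> real"
  assumes C: "finite C" "card C = p" "p > 0" and E: "E \<ge> 0"
    and M: "\<And>c. c \<in> C \<Longrightarrow> M c \<le> sum M C / real p + E"
  shows "(\<Sum>c\<in>C. (M c)\<^sup>2) \<le> (sum M C)\<^sup>2 / real p + (real p * E)\<^sup>2"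
proof -
  define \<mu> y where "\<mu> = sum M C / real p" and "y c = \<mu> + E - M c" for c
  have tot: "sum M C = real p * \<mu>" using C by (simp add: \<mu>_def)
  have y0: "y c \<ge> 0" if "c \<in> C" for c using M[OF that] by (simp add: y_def \<mu>_def)
  have sy: "sum y C = real p * E" by (simp add: y_def sum_subtractf C tot algebra_simps)
  have "(\<Sum>c\<in>C. (y c)\<^sup>2) \<le> (\<Sum>c\<in>C. y c * sum y C)"
    unfolding power2_eq_square using y0 C
    by (intro sum_mono mult_left_mono) (auto intro!: member_le_sum)
  also have "\<dots> = (real p * E)\<^sup>2" by (simp add: sy power2_eq_square flip: sum_distrib_right)
  finally have "(\<Sum>c\<in>C. (y c)\<^sup>2) \<le> (real p * E)\<^sup>2" .
  moreover have "(\<Sum>c\<in>C. (M c)\<^sup>2) = (\<Sum>c\<in>C. (\<mu> + E)\<^sup>2 - 2 * (\<mu> + E) * y c + (y c)\<^sup>2)"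
    by (intro sum.cong refl) (simp add: y_def power2_eq_square algebra_simps)
  moreover have "\<dots> = real p * (\<mu> + E)\<^sup>2 - 2 * (\<mu> + E) * (real p * E) + (\<Sum>c\<in>C. (y c)\<^sup>2)"
    by (simp add: sum.distrib sum_subtractf C sy flip: sum_distrib_left)
  moreover have "real p * (\<mu> + E)\<^sup>2 - 2 * (\<mu> + E) * (real p * E) = real p * \<mu>\<^sup>2 - real p * E\<^sup>2"
    by (simp add: power2_eq_square algebra_simps)
  moreover have "real p * \<mu>\<^sup>2 = (sum M C)\<^sup>2 / real p" using C by (simp add: tot power2_eq_square)
  moreover have "0 \<le> real p * E\<^sup>2" by simp
  ultimately show ?thesis by linarith
qed

text \<open>The congruence is solved for the coordinate at \<open>u0\<close>, all others being
  free.\<close>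

lemma card_hyperplane_ge:
  fixes \<delta> :: "'i \<Rightarrow> int"
  assumes p: "prime p" and U: "finite U" "u0 \<in> U" "\<not> int p dvd \<delta> u0"
  shows "p ^ (card U - 1) \<le> card {a \<in> U \<rightarrow>\<^sub>E {0..<int p}. int p dvd (\<Sum>u\<in>U. a u * \<delta> u)}"
proof -
  have "coprime (\<delta> u0) (int p)"
    using U(3) p by (meson coprime_commute prime_imp_coprime prime_nat_int_transfer)
  then obtain b where b: "[\<delta> u0 * b = 1] (mod int p)" using cong_solve_coprime_int by blast
  define F where "F a = a(u0 := (- b * (\<Sum>u\<in>U - {u0}. a u * \<delta> u)) mod int p)" for a :: "'i \<Rightarrow> int"
  have "card ((U - {u0}) \<rightarrow>\<^sub>E {0..<int p}) \<le> card {a \<in> U \<rightarrow>\<^sub>E {0..<int p}. int p dvd (\<Sum>u\<in>U. a u * \<delta> u)}"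
  proof (rule card_inj_on_le)
    show "inj_on F ((U - {u0}) \<rightarrow>\<^sub>E {0..<int p})"
    proof (rule inj_onI)
      fix a a' assume a: "a \<in> (U - {u0}) \<rightarrow>\<^sub>E {0..<int p}" "a' \<in> (U - {u0}) \<rightarrow>\<^sub>E {0..<int p}"
        and eq: "F a = F a'"
      have "a u = a' u" if "u \<in> U - {u0}" for u
        using fun_cong[OF eq, of u] that by (simp add: F_def)
      then show "a = a'" using a by (intro PiE_ext)
    qed
    show "F ` ((U - {u0}) \<rightarrow>\<^sub>E {0..<int p}) \<subseteq> {a \<in> U \<rightarrow>\<^sub>E {0..<int p}. int p dvd (\<Sum>u\<in>U. a u * \<delta> u)}"
    proof clarify
      fix a assume a: "a \<in> (U - {u0}) \<rightarrow>\<^sub>E {0..<int p}"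
      define s where "s = (\<Sum>u\<in>U - {u0}. a u * \<delta> u)"
      have "(\<Sum>u\<in>U. F a u * \<delta> u) = F a u0 * \<delta> u0 + (\<Sum>u\<in>U - {u0}. F a u * \<delta> u)"
        using U by (simp add: sum.remove)
      also have "(\<Sum>u\<in>U - {u0}. F a u * \<delta> u) = s"
        unfolding s_def by (intro sum.cong refl) (simp add: F_def)
      also have "F a u0 = (- b * s) mod int p" by (simp add: F_def s_def)
      finally have sum_eq: "(\<Sum>u\<in>U. F a u * \<delta> u) = (- b * s) mod int p * \<delta> u0 + s" .
      have "[(- b * s) mod int p * \<delta> u0 + s = (- b * s) * \<delta> u0 + s] (mod int p)"
        by (intro cong_add cong_mult) auto
      also have "(- b * s) * \<delta> u0 + s = s * (1 - \<delta> u0 * b)" by (simp add: algebra_simps)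
      also have "[s * (1 - \<delta> u0 * b) = s * (1 - 1)] (mod int p)"
        using b by (intro cong_mult cong_diff) auto
      finally have "int p dvd (\<Sum>u\<in>U. F a u * \<delta> u)" unfolding sum_eq by (simp add: cong_0_iff)
      moreover have "F a \<in> insert u0 (U - {u0}) \<rightarrow>\<^sub>E {0..<int p}"
        unfolding F_def by (rule PiE_fun_upd) (use a p in \<open>auto simp: prime_gt_0_nat\<close>)
      moreover have "insert u0 (U - {u0}) = U" using U by auto
      ultimately show "F a \<in> U \<rightarrow>\<^sub>E {0..<int p} \<and> int p dvd (\<Sum>u\<in>U. F a u * \<delta> u)" by simp
    qed
    show "finite {a \<in> U \<rightarrow>\<^sub>E {0..<int p}. int p dvd (\<Sum>u\<in>U. a u * \<delta> u)}"
      by (rule finite_subset[of _ "U \<rightarrow>\<^sub>E {0..<int p}"]) (use U in \<open>auto intro!: finite_PiE\<close>)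
  qed
  then show ?thesis using U by (simp add: card_PiE)
qed

lemma card_filter_eq_sum: "finite A \<Longrightarrow> card {x \<in> A. P x} = (\<Sum>x\<in>A. if P x then 1 else 0)"
  by (simp add: sum.If_cases Int_def)

text \<open>Otherwise squaring would map the residues onto themselves, hence injectively, although 1
  and -1 have the same square.\<close>

lemma exists_Legendre_neg:
  fixes p :: nat
  assumes "prime p" "odd p"
  shows "\<exists>a. Legendre a (int p) = -1"
proof (rule ccontr)
  assume no: "\<not> ?thesis"
  have p3: "p \<ge> 3" using assms prime_ge_2_nat[of p] by (cases "p = 2") auto
  define f where "f y = (y\<^sup>2) mod int p" for y
  have "{0..<int p} \<subseteq> f ` {0..<int p}"
  proof
    fix a assume a: "a \<in> {0..<int p}"
    have "\<exists>y. [y\<^sup>2 = a] (mod int p)"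
    proof (cases "[a = 0] (mod int p)")
      case True
      then show ?thesis by (intro exI[of _ 0]) (simp add: cong_sym_eq)
    next
      case False
      then show ?thesis using no[unfolded not_ex, rule_format, of a]
        by (auto simp: Legendre_def QuadRes_def split: if_splits)
    qed
    then obtain y where y: "[y\<^sup>2 = a] (mod int p)" by auto
    then have "f (y mod int p) = a" using a by (simp add: f_def cong_def power_mod)
    then show "a \<in> f ` {0..<int p}" using p3 by (intro image_eqI[of _ _ "y mod int p"]) auto
  qed
  moreover have "f ` {0..<int p} \<subseteq> {0..<int p}" using p3 by (auto simp: f_def)
  ultimately have "inj_on f {0..<int p}"
    by (intro eq_card_imp_inj_on) (auto simp: subset_antisym)
  moreover have "f 1 = f (int p - 1)"
  proof -
    have "[int p - 1 = - 1] (mod int p)" by (simp add: cong_iff_dvd_diff)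
    from cong_pow[OF this, of 2] show ?thesis by (simp add: f_def cong_def)
  qed
  ultimately have "1 = int p - 1" using p3 by (auto dest!: inj_onD)
  then show False using p3 by simp
qed

section \<open>Pairs of points with equal class vectors\<close>

context paley_field
begin

definition cls :: "'a set \<Rightarrow> 'a \<Rightarrow> 'a \<Rightarrow> int" where
  "cls U v = (\<lambda>u\<in>U. cl (v - u))"

definition same_class_pairs :: "'a set \<Rightarrow> ('a \<times> 'a) set" where
  "same_class_pairs U = {(v, v'). v \<in> - U \<and> v' \<in> - U \<and> cls U v = cls U v'}"

lemma cls_range: "cls U v \<in> U \<rightarrow>\<^sub>E {0..<int p}"
  using cl_range by (auto simp: cls_def)

lemma card_Compl: "real (card (- U)) = real n - real (card U)" for U :: "'a set"
  unfolding n by (simp add: Compl_eq_Diff_UNIV card_Diff_subset of_nat_diff card_mono)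

text \<open>If \<open>L\<close> were missed, all points off \<open>U\<close> would share the
  remaining class vectors, and Cauchy-Schwarz would force more coincident pairs than there
  are.\<close>

lemma hit_class_set:
  fixes U :: "'a set"
  assumes L: "L \<subseteq> U \<rightarrow>\<^sub>E {0..<int p}"
    and small: "(real p ^ card U - real (card L)) * real (card (same_class_pairs U)) < (real n - real (card U))\<^sup>2"
  shows "\<exists>v. v \<notin> U \<and> cls U v \<in> L"
proof (rule ccontr)
  assume "\<not> ?thesis"
  then have sub: "cls U ` (- U) \<subseteq> (U \<rightarrow>\<^sub>E {0..<int p}) - L" using cls_range by auto
  have fin: "finite (U \<rightarrow>\<^sub>E {0..<int p})" by (simp add: finite_PiE)
  have "(real (card (- U)))\<^sup>2 \<le> real (card ((U \<rightarrow>\<^sub>E {0..<int p}) - L)) * real (card (same_class_pairs U))"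
    unfolding same_class_pairs_def using fin sub by (intro card_sq_le_coincident_pairs) auto
  moreover have "real (card ((U \<rightarrow>\<^sub>E {0..<int p}) - L)) = real p ^ card U - real (card L)"
    using L fin card_mono[OF fin L]
    by (simp add: card_Diff_subset finite_subset of_nat_diff card_PiE)
  ultimately show False using small by (simp add: card_Compl)
qed

text \<open>With two centres \<open>u\<close> and \<open>w\<close>, a pair \<open>(v, v')\<close> off the diagonal can be recovered from the quotients
  \<open>(v' - u) / (v - u)\<close> and \<open>(v' - w) / (v - w)\<close>, which lie in the subgroup of index \<open>p\<close>.\<close>

lemma card_same_class_pairs_2:
  assumes U: "card U = 2"
  shows "card (same_class_pairs U) \<le> card (- U) + (h - 1) * (h - 2)"
proof -
  obtain u w where uw: "U = {u, w}" "u \<noteq> w" using U by (auto simp: card_2_iff)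
  define C where "C = {x. x \<noteq> 0 \<and> cl x = 0} - {1}"
  have cC: "card C = h - 1" using card_cl_eq_0 by (simp add: C_def card_Diff_singleton cl_1)
  have quot: "cl ((v' - t) / (v - t)) = 0" if "v \<noteq> t" "v' \<noteq> t" "cl (v - t) = cl (v' - t)" for v v' t
  proof -
    have "[cl ((v' - t) / (v - t) * (v - t)) = cl ((v' - t) / (v - t)) + cl (v - t)] (mod int p)"
      using that by (intro cl_mult) auto
    then have "[0 + cl (v - t) = cl ((v' - t) / (v - t)) + cl (v - t)] (mod int p)" using that by simp
    then have "[cl 1 = cl ((v' - t) / (v - t))] (mod int p)" unfolding cong_add_rcancel by (simp add: cl_1)
    then have "cl 1 = cl ((v' - t) / (v - t))" by (rule iffD2[OF cl_eq_iff_cong])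
    then show ?thesis by (simp add: cl_1)
  qed
  define Off where "Off = {(v, v') \<in> same_class_pairs U. v \<noteq> v'}"
  \<comment> \<open>Off the diagonal both quotients differ from 1, and they differ from each other
    because \<open>u \<noteq> w\<close>. The two equations for \<open>v'\<close> then determine
    \<open>v\<close>, whose coefficient is the difference of the quotients.\<close>
  define D where "D = (SIGMA \<alpha>:C. C - {\<alpha>})"
  define F where "F = (\<lambda>(v, v'). ((v' - u) / (v - u), (v' - w) / (v - w)))"
  have F: "F x \<in> D \<and> fst x * (fst (F x) - snd (F x)) = w - u + fst (F x) * u - snd (F x) * w
      \<and> snd x = u + fst (F x) * (fst x - u)" if "x \<in> Off" for x
  proof -
    obtain v v' where vv': "x = (v, v')" by (cases x)
    with that have x: "x = (v, v')" "v \<noteq> v'" "v \<noteq> u" "v \<noteq> w" "v' \<noteq> u" "v' \<noteq> w" "cls U v = cls U v'"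
      by (simp_all add: Off_def same_class_pairs_def uw(1))
    have cl: "cl (v - t) = cl (v' - t)" if "t \<in> U" for t
      using fun_cong[OF x(7), of t] that by (simp add: cls_def)
    define \<alpha> \<beta> where "\<alpha> = (v' - u) / (v - u)" and "\<beta> = (v' - w) / (v - w)"
    have ab: "v' = u + \<alpha> * (v - u)" "v' = w + \<beta> * (v - w)" using x by (simp_all add: \<alpha>_def \<beta>_def)
    have 1: "\<alpha> \<noteq> 1" "\<beta> \<noteq> 1" using ab x(2) by auto
    have 0: "\<alpha> \<noteq> 0" "\<beta> \<noteq> 0" using x by (auto simp: \<alpha>_def \<beta>_def)
    have c: "cl \<alpha> = 0" "cl \<beta> = 0"
      unfolding \<alpha>_def \<beta>_def using x cl uw(1) by (intro quot; simp)+
    have "\<alpha> \<noteq> \<beta>"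
    proof
      assume "\<alpha> = \<beta>"
      then have "(1 - \<alpha>) * (u - w) = 0" using ab by (simp add: algebra_simps)
      then show False using 1 uw(2) by simp
    qed
    moreover have "v * (\<alpha> - \<beta>) = w - u + \<alpha> * u - \<beta> * w" using ab by (simp add: algebra_simps)
    moreover have "(\<alpha>, \<beta>) \<in> D" using 0 1 c \<open>\<alpha> \<noteq> \<beta>\<close> by (simp add: C_def D_def)
    moreover have "F x = (\<alpha>, \<beta>)" by (simp add: F_def x(1) \<alpha>_def \<beta>_def)
    ultimately show ?thesis unfolding x(1) using ab(1) by (simp only: fst_conv snd_conv simp_thms)
  qed
  have "card Off \<le> card D"
  proof (rule card_inj_on_le)
    show "inj_on F Off"
    proof (rule inj_onI)
      fix x y assume x: "x \<in> Off" and y: "y \<in> Off" and eq: "F x = F y"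
      have "fst (F x) \<noteq> snd (F x)" using F[OF x] by (auto simp: D_def)
      moreover have "fst x * (fst (F x) - snd (F x)) = fst y * (fst (F x) - snd (F x))"
        using F[OF x] F[OF y] eq by simp
      ultimately have "fst x = fst y" by simp
      then show "x = y" using F[OF x] F[OF y] eq by (simp add: prod_eq_iff)
    qed
    show "F ` Off \<subseteq> D" using F by blast
  qed (simp add: D_def)
  also have "card D = (h - 1) * (h - 2)"
    unfolding D_def by (subst card_SigmaI) (auto simp: cC card_Diff_singleton)
  finally have Off: "card Off \<le> (h - 1) * (h - 2)" .
  have "same_class_pairs U \<subseteq> (\<lambda>v. (v, v)) ` (- U) \<union> Off"
    by (auto simp: Off_def same_class_pairs_def)
  then have "card (same_class_pairs U) \<le> card ((\<lambda>v. (v, v)) ` (- U) \<union> Off)"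
    by (intro card_mono) auto
  also have "\<dots> \<le> card (- U) + card Off"
    by (intro order.trans[OF card_Un_le] add_mono card_image_le) auto
  finally show ?thesis using Off by simp
qed

lemma residue_field_UNIV:
  assumes "primepow n"
  shows "\<exists>f. residue_field_pred (\<lambda>x::'a. x = 0) UNIV id CHAR('a) f n"
proof -
  have ch: "prime CHAR('a)"
    using prime_CHAR_semidom[where 'a = 'a] finite_imp_CHAR_pos[where 'a = 'a] by simp
  have "CHAR('a) dvd n" unfolding n by (rule CHAR_dvd_CARD)
  moreover obtain q k where q: "prime q" "n = q ^ k" using assms by (auto simp: primepow_def)
  ultimately have "CHAR('a) dvd q" using ch prime_dvd_power by blast
  then have "CHAR('a) = q" using ch q(1) primes_dvd_imp_eq by blast
  with q have nk: "n = CHAR('a) ^ k" by simp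
  have fix_n: "a ^ n = a" for a :: 'a
  proof (cases "a = 0")
    case False
    have "a ^ n = a * a ^ (n - 1)" using n_gt_1 by (simp flip: power_Suc)
    then show ?thesis using power_n_minus_1[OF False] by simp
  qed (use n_gt_1 in simp)
  have "residue_field_pred (\<lambda>x::'a. x = 0) UNIV id CHAR('a) k n"
    by unfold_locales (use ch nk fix_n n_gt_1 in auto)
  then show ?thesis by blast
qed

text \<open>A linear form in the class vector is the exponent of a character of order
  \<open>p\<close> at a product of powers of the \<open>v - u\<close>. Multiplying the form by
  \<open>i b\<close>, with \<open>b\<close> inverse to \<open>a u0\<close>, gives exponent
  \<open>i\<close> at \<open>u0\<close>, as Stepanov's method requires with \<open>d = p\<close>;
  the value \<open>c\<close> then fixes \<open>\<gamma> i\<close>.\<close>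

lemma card_character_class_le:
  fixes U :: "'a set" and a :: "'a \<Rightarrow> int"
  assumes n_pp: "primepow n" and n256: "n \<ge> 256"
    and u0: "u0 \<in> U" "\<not> int p dvd a u0"
  shows "real (card {v \<in> - U. [(\<Sum>u\<in>U. a u * cl (v - u)) = c] (mod int p)})
    \<le> real n / real p + 8 / 5 * real (card U) * sqrt (real n)"
proof -
  obtain f where "residue_field_pred (\<lambda>x::'a. x = 0) UNIV id CHAR('a) f n"
    using residue_field_UNIV[OF n_pp] by blast
  then interpret residue_field_pred "\<lambda>x::'a. x = 0" UNIV id "CHAR('a)" f n .
  have "coprime (a u0) (int p)"
    using u0(2) prime_p by (meson coprime_commute prime_imp_coprime prime_nat_int_transfer)
  then obtain b where b: "[a u0 * b = 1] (mod int p)" using cong_solve_coprime_int by blast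
  define e where "e i u = nat ((int i * b * a u) mod int p)" for i u
  define \<zeta> where "\<zeta> = g ^ h"
  have int_e: "int (e i u) = (int i * b * a u) mod int p" for i u
    using p_gt_1 by (simp add: e_def)
  show ?thesis
  proof (rule stepanov_sqrt[where s = h and ?t0.0 = u0 and e = e and \<gamma> = "\<lambda>i. \<zeta> ^ nat ((int i * b * c) mod int p)"])
    show "p * h = n - 1" by (rule h_eq)
    show "2 \<le> p" using p_gt_1 by simp
    fix i assume i: "i < p"
    have "[int i * b * a u0 = int i * 1] (mod int p)"
      using cong_mult[OF cong_refl b, of "int i"] by (simp add: mult_ac)
    then show "e i u0 = i" using i by (simp add: e_def cong_def)
    show "e i t < p" for t
      using int_e[of i t] p_gt_1 by (metis of_nat_0_less_iff of_nat_less_iff pos_mod_bound less_trans zero_less_one)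
  next
    fix v i assume v: "v \<in> {v \<in> - U. [(\<Sum>u\<in>U. a u * cl (v - u)) = c] (mod int p)}" and i: "i < p"
    let ?k = "\<Sum>u\<in>U. nat (cl (v - u)) * e i u"
    have nz: "v - u \<noteq> 0" if "u \<in> U" for u using v that by auto
    have "(\<Prod>u\<in>U. (v - u) ^ (h * e i u)) = (\<Prod>u\<in>U. \<zeta> ^ (nat (cl (v - u)) * e i u))"
      using power_h[OF nz] by (intro prod.cong refl) (simp add: power_mult \<zeta>_def)
    also have "\<dots> = \<zeta> ^ ?k" by (simp add: power_sum)
    also have "\<dots> = \<zeta> ^ (?k mod p)" unfolding \<zeta>_def by (rule power_root_mod[symmetric])
    also have "?k mod p = nat (int ?k mod int p)" by (simp only: zmod_int[symmetric] nat_int)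
    also have "int ?k mod int p = (int i * b * c) mod int p"
    proof -
      have "int ?k = (\<Sum>u\<in>U. cl (v - u) * ((int i * b * a u) mod int p))"
        using cl_range by (auto simp: int_e intro!: sum.cong)
      also have "[\<dots> = (\<Sum>u\<in>U. cl (v - u) * (int i * b * a u))] (mod int p)"
        by (intro cong_sum cong_mult) auto
      also have "(\<Sum>u\<in>U. cl (v - u) * (int i * b * a u)) = int i * b * (\<Sum>u\<in>U. a u * cl (v - u))"
        by (simp add: sum_distrib_left mult_ac)
      also have "[int i * b * (\<Sum>u\<in>U. a u * cl (v - u)) = int i * b * c] (mod int p)"
        using v by (intro cong_mult) auto
      finally show ?thesis by (simp add: cong_def)
    qed
    finally show "(\<Prod>u\<in>U. (v - u) ^ (h * e i u)) - \<zeta> ^ nat ((int i * b * c) mod int p) = 0" by simp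
  qed (use u0 n256 in auto)
qed

text \<open>Double counting of the triples \<open>(a, v, v')\<close> on which the linear form \<open>a\<close> takes equal values at the
  class vectors of \<open>v\<close> and \<open>v'\<close>.\<close>

lemma card_same_class_pairs_le:
  fixes U :: "'a set"
  assumes n_pp: "primepow n" and n256: "n \<ge> 256" and U: "U \<noteq> {}"
  defines "m \<equiv> card U" and "N \<equiv> real n - real (card U)"
  shows "real p ^ (m - 1) * (real p - 1) * real (card (same_class_pairs U))
    \<le> N\<^sup>2 * (real p - 1) / real p + real p ^ m * (17 / 10 * real p * real m * sqrt (real n))\<^sup>2"
proof -
  \<comment> \<open>The class bound has main term \<open>n / p\<close>, the mean is
    \<open>N / p\<close>; the surplus \<open>m / p\<close> fits between \<open>8 / 5\<close> and
    \<open>17 / 10\<close> because \<open>sqrt n \<ge> 10\<close>.\<close>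
  define E where "E = 17 / 10 * real m * sqrt (real n)"
  define \<Lambda> where "\<Lambda> = U \<rightarrow>\<^sub>E {0..<int p}"
  define \<psi> where "\<psi> a v = (\<Sum>u\<in>U. a u * cl (v - u)) mod int p" for a v
  define Q where "Q a = {(v, v'). v \<in> - U \<and> v' \<in> - U \<and> \<psi> a v = \<psi> a v'}" for a
  have m1: "m \<ge> 1" using U by (simp add: m_def card_gt_0_iff Suc_le_eq)
  have finL: "finite \<Lambda>" unfolding \<Lambda>_def by (simp add: finite_PiE)
  have cL: "card \<Lambda> = p ^ m" by (simp add: \<Lambda>_def m_def card_PiE)
  have p0: "real p > 0" using p_gt_1 by simp
  have E0: "E \<ge> 0" by (simp add: E_def)
  have cV: "real (card (- U)) = N" unfolding N_def by (rule card_Compl)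

  have upper0: "real (card (Q a)) \<le> N\<^sup>2" for a
  proof -
    have "card (Q a) \<le> card ((- U) \<times> (- U))" by (rule card_mono) (auto simp: Q_def)
    then have "real (card (Q a)) \<le> real (card (- U)) * real (card (- U))"
      by (simp only: card_cartesian_product of_nat_le_iff flip: of_nat_mult)
    then show ?thesis by (simp add: cV power2_eq_square)
  qed
  have upper: "real (card (Q a)) \<le> N\<^sup>2 / real p + (real p * E)\<^sup>2" if a: "a \<in> \<Lambda> - {\<lambda>u\<in>U. 0}" for a
  proof -
    obtain u0 where u0: "u0 \<in> U" "a u0 \<noteq> 0"
      using a by (auto simp: \<Lambda>_def PiE_def extensional_def fun_eq_iff restrict_def split: if_splits)
    have "a u0 \<in> {0..<int p}" using a u0 by (auto simp: \<Lambda>_def)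
    then have nd: "\<not> int p dvd a u0" using u0(2) zdvd_not_zless[of "a u0" "int p"] by auto
    define M where "M c = real (card {v \<in> - U. \<psi> a v = c})" for c
    have im: "\<psi> a ` (- U) \<subseteq> {0..<int p}" using p_gt_1 by (auto simp: \<psi>_def)
    have sumM: "sum M {0..<int p} = N"
      using card_eq_sum_fibres[OF _ _ im] cV by (simp add: M_def flip: of_nat_sum)
    have "(\<Sum>c\<in>{0..<int p}. (M c)\<^sup>2) \<le> (sum M {0..<int p})\<^sup>2 / real p + (real p * E)\<^sup>2"
    proof (rule sum_squares_le_of_upper_bound)
      fix c assume c: "c \<in> {0..<int p}"
      have "{v \<in> - U. \<psi> a v = c} = {v \<in> - U. [(\<Sum>u\<in>U. a u * cl (v - u)) = c] (mod int p)}"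
        using c by (auto simp: \<psi>_def cong_def)
      then have "M c \<le> real n / real p + 8 / 5 * (real m * sqrt (real n))"
        unfolding M_def m_def using card_character_class_le[where U = U and a = a and c = c, OF n_pp n256 u0(1) nd] by simp
      moreover have "real n / real p = N / real p + real m / real p"
        by (simp add: N_def m_def flip: add_divide_distrib)
      moreover have "real m / real p \<le> real m"
        using p_gt_1 mult_left_mono[of 1 "real p" "real m"] by (simp add: divide_le_eq)
      moreover have "10 * real m \<le> real m * sqrt (real n)"
      proof -
        have "sqrt 256 \<le> sqrt (real n)" using n256 by (intro real_sqrt_le_mono) simp
        then have "10 \<le> sqrt (real n)" using real_sqrt_unique[of 16 256] by simp
        then show ?thesis using mult_left_mono[of 10 "sqrt (real n)" "real m"] by (simp add: mult.commute)
      qed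
      moreover have "E = 17 / 10 * (real m * sqrt (real n))" by (simp add: E_def)
      ultimately show "M c \<le> sum M {0..<int p} / real p + E" unfolding sumM by linarith
    qed (use p_gt_1 E0 in auto)
    then show ?thesis
      unfolding Q_def card_coincident_pairs[OF finite finite_atLeastLessThan_int im] sumM
      by (simp add: M_def)
  qed

  define S where "S = same_class_pairs U"
  have lower: "real p ^ (m - 1) * (N\<^sup>2 - real (card S)) + real p ^ m * real (card S) \<le> (\<Sum>a\<in>\<Lambda>. real (card (Q a)))"
  proof -
    define VV where "VV = (- U) \<times> (- U)"
    have SV: "S \<subseteq> VV" by (auto simp: S_def VV_def same_class_pairs_def)
    have cVV: "real (card VV) = N\<^sup>2" by (simp add: VV_def card_cartesian_product cV power2_eq_square)
    \<comment> \<open>Equal class vectors agree under all \<open>p^m\<close> forms, unequal ones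
      under at least the \<open>p^(m - 1)\<close> forms of a hyperplane.\<close>
    have fib: "(if x \<in> S then p ^ m else p ^ (m - 1)) \<le> card {a \<in> \<Lambda>. x \<in> Q a}" if x: "x \<in> VV" for x
    proof -
      obtain v v' where v: "x = (v, v')" "v \<in> - U" "v' \<in> - U" using x by (auto simp: VV_def)
      show ?thesis
      proof (cases "x \<in> S")
        case True
        then have eq: "cls U v = cls U v'" using v by (simp add: S_def same_class_pairs_def)
        have "cl (v - u) = cl (v' - u)" if "u \<in> U" for u
          using fun_cong[OF eq, of u] that by (simp add: cls_def)
        then have "{a \<in> \<Lambda>. x \<in> Q a} = \<Lambda>" using v by (auto simp: Q_def \<psi>_def)
        then show ?thesis using True cL by simp
      next
        case False
        then have "cls U v \<noteq> cls U v'" using v by (auto simp: S_def same_class_pairs_def)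
        then obtain u0 where u0: "u0 \<in> U" "cl (v - u0) \<noteq> cl (v' - u0)"
          by (auto simp: cls_def fun_eq_iff split: if_splits)
        define \<delta> where "\<delta> u = cl (v - u) - cl (v' - u)" for u
        have "\<not> int p dvd \<delta> u0"
          using u0(2) by (simp add: \<delta>_def cl_eq_iff_cong cong_iff_dvd_diff)
        then have "p ^ (m - 1) \<le> card {a \<in> \<Lambda>. int p dvd (\<Sum>u\<in>U. a u * \<delta> u)}"
          unfolding m_def \<Lambda>_def using prime_p u0(1) by (intro card_hyperplane_ge) auto
        also have "{a \<in> \<Lambda>. int p dvd (\<Sum>u\<in>U. a u * \<delta> u)} = {a \<in> \<Lambda>. x \<in> Q a}"
          using v by (auto simp: Q_def \<psi>_def mod_eq_dvd_iff \<delta>_def right_diff_distrib sum_subtractf)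
        finally show ?thesis using False by simp
      qed
    qed
    have "(\<Sum>x\<in>VV. if x \<in> S then p ^ m else p ^ (m - 1)) \<le> (\<Sum>x\<in>VV. card {a \<in> \<Lambda>. x \<in> Q a})"
      by (rule sum_mono) (rule fib)
    also have "\<dots> = (\<Sum>x\<in>VV. \<Sum>a\<in>\<Lambda>. if x \<in> Q a then 1 else 0)"
      by (simp add: card_filter_eq_sum finL)
    also have "\<dots> = (\<Sum>a\<in>\<Lambda>. \<Sum>x\<in>VV. if x \<in> Q a then 1 else 0)" by (rule sum.swap)
    also have "\<dots> = (\<Sum>a\<in>\<Lambda>. card {x \<in> VV. x \<in> Q a})" by (simp add: card_filter_eq_sum)
    also have "\<dots> = (\<Sum>a\<in>\<Lambda>. card (Q a))"
      by (intro sum.cong refl arg_cong[of _ _ card]) (auto simp: VV_def Q_def)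
    finally have "real (\<Sum>x\<in>VV. if x \<in> S then p ^ m else p ^ (m - 1)) \<le> real (\<Sum>a\<in>\<Lambda>. card (Q a))"
      by (simp only: of_nat_le_iff)
    moreover have "(\<Sum>x\<in>VV. if x \<in> S then p ^ m else p ^ (m - 1)) = p ^ m * card S + p ^ (m - 1) * card (VV - S)"
      using SV by (simp add: sum.If_cases Int_absorb1 Diff_eq mult.commute)
    moreover have "real (card (VV - S)) = N\<^sup>2 - real (card S)"
      using SV cVV card_mono[OF _ SV] by (simp add: card_Diff_subset of_nat_diff)
    ultimately show ?thesis by simp
  qed
  have zero: "(\<lambda>u\<in>U. 0) \<in> \<Lambda>" using p_gt_1 by (auto simp: \<Lambda>_def)
  have "(\<Sum>a\<in>\<Lambda>. real (card (Q a))) = real (card (Q (\<lambda>u\<in>U. 0))) + (\<Sum>a\<in>\<Lambda> - {\<lambda>u\<in>U. 0}. real (card (Q a)))"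
    using zero finL by (simp add: sum.remove)
  also have "\<dots> \<le> N\<^sup>2 + (\<Sum>a\<in>\<Lambda> - {\<lambda>u\<in>U. 0}. N\<^sup>2 / real p + (real p * E)\<^sup>2)"
    by (intro add_mono upper0 sum_mono upper)
  also have "\<dots> = N\<^sup>2 + (real p ^ m - 1) * (N\<^sup>2 / real p + (real p * E)\<^sup>2)"
    using zero finL p_gt_1 by (simp add: card_Diff_singleton cL of_nat_diff)
  also have "\<dots> \<le> N\<^sup>2 + (real p ^ m - 1) * (N\<^sup>2 / real p) + real p ^ m * (real p * E)\<^sup>2"
    by (simp add: algebra_simps)
  finally have total: "(\<Sum>a\<in>\<Lambda>. real (card (Q a)))
      \<le> N\<^sup>2 + (real p ^ m - 1) * (N\<^sup>2 / real p) + real p ^ m * (real p * E)\<^sup>2" .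
  have pm: "real p ^ m = real p * real p ^ (m - 1)" using m1 by (cases m) auto
  have "real p ^ (m - 1) * (real p - 1) * real (card S)
      = (real p ^ (m - 1) * (N\<^sup>2 - real (card S)) + real p ^ m * real (card S)) - real p ^ (m - 1) * N\<^sup>2"
    unfolding pm by (simp add: algebra_simps)
  also have "\<dots> \<le> N\<^sup>2 + (real p ^ m - 1) * (N\<^sup>2 / real p) + real p ^ m * (real p * E)\<^sup>2 - real p ^ (m - 1) * N\<^sup>2"
    using lower total by linarith
  also have "(real p ^ m - 1) * (N\<^sup>2 / real p) = real p ^ (m - 1) * N\<^sup>2 - N\<^sup>2 / real p"
    unfolding pm using p0 by (simp add: field_simps)
  also have "N\<^sup>2 + (real p ^ (m - 1) * N\<^sup>2 - N\<^sup>2 / real p) + real p ^ m * (real p * E)\<^sup>2 - real p ^ (m - 1) * N\<^sup>2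
      = N\<^sup>2 * (real p - 1) / real p + real p ^ m * (real p * E)\<^sup>2"
    using p0 by (simp add: field_simps)
  also have "real p * E = 17 / 10 * real p * real m * sqrt (real n)" by (simp add: E_def)
  finally show ?thesis by (simp add: S_def)
qed

end

section \<open>Ampleness\<close>

text \<open>If the claim failed, the error term would have to outweigh the density of
  \<open>L\<close>, giving \<open>N^2 (p - 1) \<le> 2.89 Q n^2\<close> with
  \<open>2.89 = (17 / 10)^2\<close>. But \<open>p - 1 \<ge> 4 Q\<close> and
  \<open>N \<ge> 99 / 100 n\<close> make the left side at least \<open>3.92 Q n^2\<close>.\<close>

lemma pair_bound_numeric:
  fixes p m n S L Q N :: real and k :: nat
  assumes k: "k \<ge> 1" and m: "m \<ge> 1" and Q: "Q > 0" and p: "p - 1 \<ge> 4 * Q" "p \<ge> 100"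
    and n: "n > m\<^sup>2 * p ^ (k + 3)" and N: "N = n - m"
    and S: "S \<ge> 0" "p ^ (k - 1) * (p - 1) * S \<le> N\<^sup>2 * (p - 1) / p + p ^ k * (17 / 10 * p * m * sqrt n)\<^sup>2"
    and L: "p ^ k \<le> L * Q" "L \<le> p ^ k"
  shows "(p ^ k - L) * S < N\<^sup>2"
proof (rule ccontr)
  assume "\<not> ?thesis"
  then have neg: "N\<^sup>2 \<le> (p ^ k - L) * S" by simp
  have n0: "n > 0" by (rule order.strict_trans1[OF _ n]) (use p in simp)
  define B where "B = 289 / 100 * (p\<^sup>2 * m\<^sup>2 * n)"
  have B0: "B \<ge> 0" using n0 by (simp add: B_def)
  have "(17 / 10 * p * m * sqrt n)\<^sup>2 = B"
    using n0 by (simp add: B_def power_mult_distrib power_divide)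
  then have "p * (p ^ (k - 1) * (p - 1) * S) \<le> p * (N\<^sup>2 * (p - 1) / p + p ^ k * B)"
    using S(2) p by (intro mult_left_mono) auto
  moreover have pk: "p ^ k = p * p ^ (k - 1)" using k by (cases k) auto
  ultimately have S': "S * (p - 1) * p ^ k \<le> N\<^sup>2 * (p - 1) + p * p ^ k * B"
    using p by (simp add: distrib_left mult_ac)
  have L0: "L \<ge> 0"
  proof -
    have "0 \<le> L * Q" using L(1) p by (smt (verit) zero_le_power)
    then show ?thesis using Q by (simp add: zero_le_mult_iff)
  qed
  have "N\<^sup>2 * ((p - 1) * p ^ k) \<le> (p ^ k - L) * S * ((p - 1) * p ^ k)"
    using neg p by (intro mult_right_mono) auto
  also have "\<dots> = (p ^ k - L) * (S * (p - 1) * p ^ k)" by (simp add: mult_ac)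
  also have "\<dots> \<le> (p ^ k - L) * (N\<^sup>2 * (p - 1) + p * p ^ k * B)"
    using S' L(2) by (intro mult_left_mono) auto
  also have "\<dots> = N\<^sup>2 * ((p - 1) * p ^ k) - L * (N\<^sup>2 * (p - 1)) + (p ^ k - L) * (p * p ^ k * B)"
    by (simp add: algebra_simps)
  also have "(p ^ k - L) * (p * p ^ k * B) \<le> p ^ k * (p * p ^ k * B)"
    using L0 B0 p by (intro mult_right_mono) auto
  finally have "L * (N\<^sup>2 * (p - 1)) \<le> p ^ k * (p * p ^ k * B)" by simp
  then have "Q * (L * (N\<^sup>2 * (p - 1))) \<le> Q * (p ^ k * (p * p ^ k * B))"
    using Q by (intro mult_left_mono) auto
  moreover have "p ^ k * (N\<^sup>2 * (p - 1)) \<le> L * Q * (N\<^sup>2 * (p - 1))"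
    using L(1) p by (intro mult_right_mono) auto
  ultimately have "p ^ k * (N\<^sup>2 * (p - 1)) \<le> p ^ k * (Q * (p * p ^ k * B))"
    by (simp add: mult_ac)
  then have "N\<^sup>2 * (p - 1) \<le> Q * (p * p ^ k * B)" using p by simp
  also have "p * p ^ k * B = 289 / 100 * (m\<^sup>2 * p ^ (k + 3) * n)"
    by (simp add: B_def power_add power2_eq_square power3_eq_cube)
  also have "Q * (289 / 100 * (m\<^sup>2 * p ^ (k + 3) * n)) \<le> Q * (289 / 100 * (n * n))"
    using n n0 Q by (intro mult_left_mono mult_right_mono) auto
  finally have upper: "N\<^sup>2 * (p - 1) \<le> 289 / 100 * (Q * n\<^sup>2)" by (simp add: power2_eq_square mult_ac)
  have "100 * m \<le> n"
  proof -
    have "m * 1 \<le> m * m" using m by (intro mult_left_mono) auto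
    moreover have "p ^ 1 \<le> p ^ (k + 3)" using p by (intro power_increasing) auto
    ultimately have "m * 100 \<le> m\<^sup>2 * p ^ (k + 3)"
      using p m by (intro mult_mono) (auto simp: power2_eq_square)
    then show ?thesis using n by linarith
  qed
  then have "(99 / 100 * n)\<^sup>2 \<le> N\<^sup>2" unfolding N using n0 by (intro power_mono) auto
  then have "(99 / 100 * n)\<^sup>2 * (4 * Q) \<le> N\<^sup>2 * (p - 1)" using p Q by (intro mult_mono) auto
  moreover have "(99 / 100 * n)\<^sup>2 * (4 * Q) = 9801 / 2500 * (Q * n\<^sup>2)"
    by (simp add: power2_eq_square)
  ultimately have "9801 / 2500 * (Q * n\<^sup>2) \<le> 289 / 100 * (Q * n\<^sup>2)"
    using upper by linarith
  moreover have "Q * n\<^sup>2 > 0" using Q n0 by simp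
  ultimately show False by linarith
qed

context paley_field
begin

lemma exists_vertex_with_signs:
  fixes U :: "'a set" and \<epsilon> :: "'a set \<Rightarrow> int"
  assumes n_pp: "primepow n" and r: "r \<ge> 1" and U: "card U \<le> r" "U \<noteq> {}"
    and big_p: "p > 2 ^ (2 ^ r + 2 * r)" and big_n: "n > r\<^sup>2 * p ^ (2 * r)"
    and \<epsilon>: "\<And>\<tau>. \<epsilon> \<tau> \<in> {-1, 1}"
  shows "\<exists>v. v \<notin> U \<and> cls U v \<in> sign_solutions p pw \<epsilon> U"
proof -
  define m where "m = card U"
  let ?L = "sign_solutions p pw \<epsilon> U"
  have L_sub: "?L \<subseteq> U \<rightarrow>\<^sub>E {0..<int p}" by (auto simp: sign_solutions_def)
  have m1: "m \<ge> 1" using U by (simp add: m_def card_gt_0_iff Suc_le_eq)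
  \<comment> \<open>The character sum bound behind the case \<open>m \<ge> 3\<close> needs about \<open>m\<^sup>2 p^(m + 3)\<close> field elements, which
    \<open>n > r\<^sup>2 p^(2 r)\<close> provides only from \<open>m = 3\<close> on.\<close>
  consider "m = 1" | "m = 2" | "m \<ge> 3" using m1 by linarith
  then show ?thesis
  proof cases
    case 1
    then obtain u where u: "U = {u}" unfolding m_def by (auto simp: card_1_singleton_iff)
    obtain a where a: "Legendre a (int p) = \<epsilon> {u}"
    proof -
      have "Legendre 1 (int p) = 1"
        using p_gt_1 by (auto simp: Legendre_def QuadRes_def cong_def intro!: exI[of _ 1])
      then show ?thesis using that \<epsilon>[of "{u}"] exists_Legendre_neg[OF prime_p odd_p] by auto
    qed
    \<comment> \<open>With a single vertex the class of \<open>v - u\<close> is unrestricted, so a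
      power of \<open>g\<close> of the wanted class serves directly.\<close>
    define v where "v = u + g ^ nat (a mod int p)"
    have cl_v: "cl (v - u) = a mod int p" using p_gt_1 by (simp add: v_def cl_power)
    have "Legendre (a mod int p) (int p) = Legendre a (int p)"
      by (simp add: Legendre_def QuadRes_def cong_def)
    then have "Legendre (pw {u} + sum (cls U v) {u}) (int p) = \<epsilon> {u}"
      using a by (simp add: pw_def pair_weight_def cls_def u cl_v)
    then have "cls U v \<in> ?L" using cls_range by (auto simp: sign_solutions_def u subset_singleton_iff)
    moreover have "v \<notin> U" using g_nonzero by (simp add: v_def u)
    ultimately show ?thesis by blast
  next
    case 2
    then have r2: "r \<ge> 2" using U by (simp add: m_def)
    have "p ^ m \<le> card ?L * 2 ^ (2 ^ m + m + 1)"
      unfolding m_def using U by (intro power_le_card_sign_solutions'[OF prime_p r2 big_p \<epsilon>]) auto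
    moreover have "p ^ m > 0" using p_gt_1 by simp
    \<comment> \<open>One admissible vector is enough here: the elementary count of pairs is so
      close to its minimum that \<open>p^2 - 1\<close> class vectors cannot hold all points.\<close>
    ultimately have L1: "card ?L \<ge> 1" by (metis Suc_le_eq One_nat_def gr0I leD mult_0)
    have "1 * p ^ 4 \<le> r\<^sup>2 * p ^ (2 * r)"
      using r2 p_gt_1 by (intro mult_mono power_increasing) (auto simp: power2_eq_square)
    then have "p ^ 4 < n" using big_n by linarith
    then have n4: "real p ^ 4 + 1 \<le> real n" by (metis Suc_eq_plus1 Suc_le_eq of_nat_1 of_nat_add of_nat_le_iff of_nat_power)
    define N where "N = real n - 2"
    have pr: "real p \<ge> 2" using p_gt_1 by simp
    have p4: "real p ^ 4 \<ge> 2 ^ 4" by (rule power_mono) (use pr in auto)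
    have N0: "N > 0" using n4 p4 by (simp add: N_def)
    have "card (same_class_pairs U) \<le> card (- U) + (h - 1) * (h - 2)"
      using 2 by (intro card_same_class_pairs_2) (simp add: m_def)
    then have "real (card (same_class_pairs U)) \<le> real (card (- U)) + real ((h - 1) * (h - 2))"
      by (simp only: of_nat_le_iff flip: of_nat_add)
    then have S: "real (card (same_class_pairs U)) \<le> N + real (h - 1) * real (h - 2)"
      using 2 by (simp add: card_Compl N_def m_def)
    have h_real: "real p * real h = real n - 1"
      using h_eq n_gt_1 by (metis of_nat_mult of_nat_diff of_nat_1 less_imp_le)
    have h1: "real p * real (h - 1) \<le> N"
    proof (cases "h = 0")
      case False
      then have "real p * real (h - 1) = real p * real h - real p" by (simp add: of_nat_diff algebra_simps)
      then show ?thesis using h_real pr by (simp add: N_def)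
    qed (use N0 in simp)
    have "(real p * real (h - 1)) * (real p * real (h - 2)) \<le> N * N"
    proof (rule mult_mono[OF h1])
      have "real p * real (h - 2) \<le> real p * real (h - 1)" by (intro mult_left_mono) auto
      then show "real p * real (h - 2) \<le> N" using h1 by linarith
    qed (use N0 in auto)
    then have hh: "(real p)\<^sup>2 * (real (h - 1) * real (h - 2)) \<le> N\<^sup>2" by (simp add: power2_eq_square mult_ac)
    have p2: "(real p)\<^sup>2 - 1 \<ge> 0" using pr one_le_power[of "real p" 2] by simp
    have "(real p ^ 2 - real (card ?L)) * real (card (same_class_pairs U))
        \<le> ((real p)\<^sup>2 - 1) * (N + real (h - 1) * real (h - 2))"
      using L1 S p2 by (intro mult_mono) auto
    also have "\<dots> < N\<^sup>2"
    proof -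
      have "(real p)\<^sup>2 * (((real p)\<^sup>2 - 1) * (N + real (h - 1) * real (h - 2)))
          = ((real p)\<^sup>2 - 1) * ((real p)\<^sup>2 * N + (real p)\<^sup>2 * (real (h - 1) * real (h - 2)))"
        by (simp add: algebra_simps)
      also have "\<dots> \<le> ((real p)\<^sup>2 - 1) * ((real p)\<^sup>2 * N + N\<^sup>2)"
        using p2 hh by (intro mult_left_mono) auto
      also have "\<dots> = (real p)\<^sup>2 * N\<^sup>2 - N * (N - real p ^ 4 + (real p)\<^sup>2)"
        by (simp add: algebra_simps power2_eq_square power4_eq_xxxx)
      also have "\<dots> < (real p)\<^sup>2 * N\<^sup>2"
      proof -
        have "(real p)\<^sup>2 \<ge> 2\<^sup>2" by (rule power_mono) (use pr in auto)
        then have "N - real p ^ 4 + (real p)\<^sup>2 > 0" using n4 by (simp add: N_def)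
        then show ?thesis using N0 by simp
      qed
      finally show ?thesis using pr by (simp add: mult_less_cancel_left)
    qed
    finally have "\<exists>v. v \<notin> U \<and> cls U v \<in> ?L"
      using 2 L_sub by (intro hit_class_set) (simp_all add: m_def N_def)
    then show ?thesis .
  next
    case 3
    then have r3: "r \<ge> 3" "m \<le> r" using U by (auto simp: m_def)
    define Q where "Q = (2::nat) ^ (2 ^ m + m + 1)"
    have L: "p ^ m \<le> card ?L * Q"
      unfolding m_def Q_def using U r3 by (intro power_le_card_sign_solutions'[OF prime_p _ big_p \<epsilon>]) auto
    have "card ?L \<le> p ^ m"
      using card_mono[OF _ L_sub] by (simp add: finite_PiE card_PiE m_def)
    have "(2::nat) ^ m \<le> 2 ^ r" using r3 by (intro power_increasing) auto
    \<comment> \<open>\<open>m \<ge> 3\<close> gives \<open>m + 3 \<le> 2 r\<close>; the 2 added to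
      the exponent becomes the factor 4 in \<open>4 * Q < p\<close>.\<close>
    then have "2 ^ m + m + 1 + 2 \<le> 2 ^ r + 2 * r" using r3 3 by linarith
    then have "(2::nat) ^ (2 ^ m + m + 1 + 2) \<le> 2 ^ (2 ^ r + 2 * r)" by (intro power_increasing) auto
    then have "4 * Q < p" using big_p by (simp add: Q_def power_add)
    then have p4Q: "real p - 1 \<ge> 4 * real Q" by linarith
    have "(2::nat) ^ 8 \<le> 2 ^ (2 ^ r + 2 * r)"
    proof (rule power_increasing)
      have "(2::nat) ^ 3 \<le> 2 ^ r" using r3 by (intro power_increasing) auto
      then show "8 \<le> 2 ^ r + 2 * r" by simp
    qed simp
    then have p256: "p \<ge> 256" using big_p by simp
    have "m\<^sup>2 * p ^ (m + 3) \<le> r\<^sup>2 * p ^ (2 * r)"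
      using r3 p_gt_1 3 by (intro mult_mono power_increasing power_mono) auto
    then have n_big: "m\<^sup>2 * p ^ (m + 3) < n" using big_n by linarith
    have n256: "n \<ge> 256"
    proof -
      have "1 * p ^ 1 \<le> m\<^sup>2 * p ^ (m + 3)"
        using 3 p_gt_1 by (intro mult_mono power_increasing) auto
      then show ?thesis using n_big p256 by simp
    qed
    have "(real p ^ m - real (card ?L)) * real (card (same_class_pairs U)) < (real n - real m)\<^sup>2"
    proof (rule pair_bound_numeric[where Q = "real Q" and m = "real m" and n = "real n"])
      show "(real m)\<^sup>2 * real p ^ (m + 3) < real n"
        using n_big by (metis of_nat_less_iff of_nat_mult of_nat_power)
      show "real p ^ m \<le> real (card ?L) * real Q"
        using L by (metis of_nat_le_iff of_nat_mult of_nat_power)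
      show "real (card ?L) \<le> real p ^ m"
        using \<open>card ?L \<le> p ^ m\<close> by (metis of_nat_le_iff of_nat_power)
      show "real p ^ (m - 1) * (real p - 1) * real (card (same_class_pairs U))
        \<le> (real n - real m)\<^sup>2 * (real p - 1) / real p
          + real p ^ m * (17 / 10 * real p * real m * sqrt (real n))\<^sup>2"
        unfolding m_def by (rule card_same_class_pairs_le[OF n_pp n256 U(2)])
    qed (use 3 p4Q p256 in \<open>auto simp: Q_def\<close>)
    then show ?thesis using L_sub by (intro hit_class_set) (simp_all add: m_def)
  qed
qed

end

theorem theorem6p1:
  fixes r n p :: nat and g :: "'a::{field,finite}"
  assumes "r \<ge> 1"
    and "n = CARD('a)" and "primepow n" and "odd n"
    and "prime p" and "odd p" and "p dvd n - 1"
    and "primitive_element g"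
    and "p > 2 ^ (2 ^ r + 2 * r)"
    and "n > r\<^sup>2 * p ^ (2 * r)"
  shows "ample_complex r (iterated_paley_complex p g)"
proof -
  interpret paley_field n p g
    by unfold_locales (fact assms)+
  let ?X = "iterated_paley_complex p g"
  have "\<exists>v \<in> vertex_set ?X - U. vertex_link ?X v \<inter> induced_subcomplex ?X U = A"
    if U: "card U \<le> r" and A: "abstract_simplicial_complex A" "A \<subseteq> induced_subcomplex ?X U" for U A
  proof (cases "U = {}")
    \<comment> \<open>Simplices are nonempty, so nothing lies inside the empty \<open>U\<close>;
      hence \<open>A\<close> is empty and every vertex serves.\<close>
    case True
    then have "induced_subcomplex ?X U = {}"
      by (auto simp: induced_subcomplex_def mem_complex_iff)
    then show ?thesis using A(2) True by (auto simp: vertex_set_complex)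
  next
    case False
    have "\<exists>v. v \<notin> U \<and> cls U v \<in> sign_solutions p pw (\<lambda>\<tau>. if \<tau> \<in> A then 1 else -1) U"
      by (rule exists_vertex_with_signs[OF assms(3,1) U False assms(9,10)]) simp
    then obtain v where "v \<notin> U" "cls U v \<in> sign_solutions p pw (\<lambda>\<tau>. if \<tau> \<in> A then 1 else -1) U"
      by blast
    then have "vertex_link ?X v \<inter> induced_subcomplex ?X U = A"
      using A by (intro link_of_sign_solution) (simp_all add: cls_def)
    with \<open>v \<notin> U\<close> show ?thesis by (auto simp: vertex_set_complex)
  qed
  then show ?thesis
    unfolding ample_complex_def using complex_is_complex singleton_mem_complex by blast
qed

end
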